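(* Let $k$ be an algebraically closed field of characteristic zero, and let $f(y,y')\in k(t)[y,y']$ be an irreducible first order differential polynomial, i.e. $f$ is irreducible over $k(t)$ as a polynomial in the two variables $y,y'$, and $\deg(f,y')\ge 1$. Assume that $\deg(f,y)>2\deg(f,y')$ or $\deg(f,y)<\deg(f,y')$. Put $\rho=\operatorname{tdeg}(f)$. If $r(t)\in k(t)$ is a rational solution of $f(y,y')=0$ with $\deg(r(t))\ge 1$, then $$ \deg(r(t))\leq \begin{cases} 75\cdot 2^{13}\cdot(\rho+1)^{40(\rho+1)^{12}+7}\,\mathfrak{h}(f), & \text{if } \deg(f,y)>2\deg(f,y'),\\ 75\cdot 2^{13}\cdot(\rho+1)^{40(\rho+1)^{12}+7}\,\mathfrak{h}(f)+(\rho+1)^2, & \text{if } \deg(f,y)<\deg(f,y'). \end{cases} $$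
   Context: $k(t)$ is the field of rational functions in $t$ over $k$, with derivation $'=\mathrm{d}/\mathrm{d}t$. For $f\in k(t)[y,y']$, the symbols $y,y'$ are regarded as two independent variables; $\deg(f,y)$, $\deg(f,y')$ are the partial degrees and $\operatorname{tdeg}(f)$ is the total degree of $f$ in $y,y'$. A rational solution of $f(y,y')=0$ is an $r(t)\in k(t)$ with $f(r(t),r'(t))=0$. For $r\in k(t)$ written as a quotient of coprime polynomials, $\deg(r)$ is the maximum of the degrees of numerator and denominator. Height of a polynomial: for $(a_0,\dots,a_m)\in k(t)^{m+1}$ not all zero, put $\mathfrak{h}((a_0:\dots:a_m))=\sum_{\mathfrak p}\max_{0\le i\le m}\{-\operatorname{ord}_{\mathfrak p}(a_i)\}$, where $\mathfrak p$ ranges over all places of $k(t)$ over $k$ (i.e. the points $c\in k$, with $\operatorname{ord}_{c}$ the order of vanishing at $t=c$, and the point at infinity, with $\operatorname{ord}_\infty(g/h)=\deg h-\deg g$), and $\operatorname{ord}_{\mathfrak p}(0)=\infty$. This does not depend on the choice of homogeneous coordinates. For a nonzero polynomial $f$ over $k(t)$, $\mathfrak{h}(f)=0$ if $f$ has exactly one term, and otherwise $\mathfrak{h}(f)$ is the height of the projective point whose coordinates are the coefficients of $f$. *)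

theory Defs
  imports "HOL-Computational_Algebra.Computational_Algebra"
begin

section \<open>The differential field \<open>k(t)\<close>\<close>

type_synonym 'a ratfun = "'a poly fract"

text \<open>
  The functions on \<open>k(t)\<close> below are given by formulas on fractions, with \<open>THE\<close> selecting the
  common value over all admissible representations; the lemmas ending in \<open>_Fract\<close> show that
  this value is well defined.
\<close>

definition ratfun_deriv :: "'a::field ratfun \<Rightarrow> 'a ratfun" where
  "ratfun_deriv r =
    (THE s. \<exists>p q. q \<noteq> 0 \<and> r = Fract p q \<and> s = Fract (pderiv p * q - p * pderiv q) (q ^ 2))"

lemma ratfun_deriv_Fract:
  assumes "q \<noteq> 0"
  shows "ratfun_deriv (Fract p q) = Fract (pderiv p * q - p * pderiv q) (q ^ 2)"
  unfolding ratfun_deriv_def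
proof (rule the_equality)
  show "\<exists>p' q'. q' \<noteq> 0 \<and> Fract p q = Fract p' q' \<and>
      Fract (pderiv p * q - p * pderiv q) (q ^ 2) = Fract (pderiv p' * q' - p' * pderiv q') (q' ^ 2)"
    using assms by blast
next
  fix s
  assume "\<exists>p' q'. q' \<noteq> 0 \<and> Fract p q = Fract p' q' \<and>
      s = Fract (pderiv p' * q' - p' * pderiv q') (q' ^ 2)"
  then obtain c d where d: "d \<noteq> 0" and eq: "p * d = c * q"
      and s: "s = Fract (pderiv c * d - c * pderiv d) (d ^ 2)"
    using assms by (auto simp: eq_fract)
  from eq have "pderiv (p * d) = pderiv (c * q)" by simp
  then have D: "pderiv p * d + p * pderiv d = pderiv c * q + c * pderiv q"
    by (simp add: pderiv_mult algebra_simps)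
  have "(pderiv p * q - p * pderiv q) * d\<^sup>2 - (pderiv c * d - c * pderiv d) * q\<^sup>2 =
    q * d * ((pderiv p * d + p * pderiv d) - (pderiv c * q + c * pderiv q))
    - (p * d - c * q) * (pderiv q * d + q * pderiv d)"
    by (simp add: algebra_simps power2_eq_square)
  also have "\<dots> = 0" using D eq by simp
  finally show "s = Fract (pderiv p * q - p * pderiv q) (q ^ 2)"
    unfolding s using assms d by (simp add: eq_fract)
qed

lemma poly_bezout_gcd:
  fixes x y :: "'a::field poly"
  assumes "x \<noteq> 0 \<or> y \<noteq> 0"
  obtains g u v where "g \<noteq> 0" "g dvd x" "g dvd y" "u * x + v * y = g"
proof -
  define I where "I = {u * x + v * y | u v. True}"
  have I_closed: "w - s * z \<in> I" if wz: "w \<in> I" "z \<in> I" for w z s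
  proof -
    from wz obtain u v u' v' where "w = u * x + v * y" "z = u' * x + v' * y"
      unfolding I_def by blast
    then have "w - s * z = (u - s * u') * x + (v - s * v') * y"
      by (simp add: algebra_simps)
    then show ?thesis unfolding I_def by blast
  qed
  have xI: "x \<in> I" unfolding I_def by (rule CollectI, rule exI[of _ 1], rule exI[of _ 0]) simp
  have yI: "y \<in> I" unfolding I_def by (rule CollectI, rule exI[of _ 0], rule exI[of _ 1]) simp
  have "\<exists>g. g \<in> I \<and> g \<noteq> 0" using xI yI assms by blast
  then obtain g where g: "g \<in> I" "g \<noteq> 0"
      and gmin: "\<And>z. z \<in> I \<Longrightarrow> z \<noteq> 0 \<Longrightarrow> degree g \<le> degree z"
    using exists_least_iff[of "\<lambda>n. \<exists>g. g \<in> I \<and> g \<noteq> 0 \<and> degree g = n"]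
    by (metis not_le_imp_less)
  have g_dvd: "g dvd z" if "z \<in> I" for z
  proof (rule ccontr)
    assume "\<not> g dvd z"
    then have nz: "z mod g \<noteq> 0" by (simp add: mod_eq_0_iff_dvd)
    have "z mod g = z - (z div g) * g" by (simp add: minus_div_mult_eq_mod)
    then have "z mod g \<in> I" using I_closed[OF that g(1)] by simp
    with gmin nz have "degree g \<le> degree (z mod g)" by blast
    with degree_mod_less[OF g(2), of z] nz show False by simp
  qed
  from g(1) obtain u v where "u * x + v * y = g" unfolding I_def by blast
  with that g(2) g_dvd[OF xI] g_dvd[OF yI] show ?thesis by blast
qed

lemma poly_coprime_dvd_mult:
  fixes x y z :: "'a::field poly"
  assumes "coprime x y" "y dvd x * z"
  shows "y dvd z"
proof -
  have "x \<noteq> 0 \<or> y \<noteq> 0" using assms(1) by auto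
  then obtain g u v where g: "g dvd x" "g dvd y" "u * x + v * y = g"
    by (rule poly_bezout_gcd) blast
  from assms(1) g(1,2) have "g dvd 1" by (rule coprime_common_divisor)
  then obtain h where h: "1 = g * h" by (auto elim: dvdE)
  have "z = (u * x + v * y) * h * z" using g(3) h by simp
  also have "\<dots> = u * h * (x * z) + y * (v * h * z)" by (simp add: algebra_simps)
  finally show ?thesis using assms(2) by (metis dvd_add dvd_mult dvd_triv_left)
qed

lemma ratfun_coprime_cases:
  fixes r :: "'a::field ratfun"
  obtains p q where "q \<noteq> 0" "coprime p q" "r = Fract p q"
proof -
  obtain a b where r: "r = Fract a b" and b: "b \<noteq> 0" by (cases r)
  from b obtain g u v where g: "g \<noteq> 0" "g dvd a" "g dvd b" "u * a + v * b = g"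
    by (metis poly_bezout_gcd)
  from g(2,3) obtain p q where pq: "a = g * p" "b = g * q" by (auto elim!: dvdE)
  have "g * (u * p + v * q) = g * 1" using g(4) pq by (simp add: algebra_simps)
  then have "u * p + v * q = 1" using g(1) by (simp only: mult_cancel_left) simp
  then have "coprime p q" by (metis coprimeI dvd_add dvd_mult)
  moreover have "q \<noteq> 0" using b pq by auto
  moreover have "r = Fract p q" using r pq g(1) by (simp add: mult_fract_cancel)
  ultimately show ?thesis using that by blast
qed

definition ratfun_degree :: "'a::field ratfun \<Rightarrow> nat" where
  "ratfun_degree r =
    (THE d. \<exists>p q. q \<noteq> 0 \<and> coprime p q \<and> r = Fract p q \<and> d = max (degree p) (degree q))"

lemma ratfun_degree_Fract:
  assumes "q \<noteq> 0" "coprime p q"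
  shows "ratfun_degree (Fract p q) = max (degree p) (degree q)"
  unfolding ratfun_degree_def
proof (rule the_equality)
  show "\<exists>p' q'. q' \<noteq> 0 \<and> coprime p' q' \<and> Fract p q = Fract p' q' \<and>
      max (degree p) (degree q) = max (degree p') (degree q')"
    using assms by blast
next
  fix d
  assume "\<exists>p' q'. q' \<noteq> 0 \<and> coprime p' q' \<and> Fract p q = Fract p' q' \<and>
      d = max (degree p') (degree q')"
  then obtain p' q' where *: "q' \<noteq> 0" "coprime p' q'" "p * q' = p' * q"
      and d: "d = max (degree p') (degree q')"
    using assms by (auto simp: eq_fract)
  have "q dvd p * q'" using *(3) by simp
  then have "q dvd q'" using assms(2) poly_coprime_dvd_mult by blast
  moreover have "q' dvd p' * q" using *(3) by (metis dvd_triv_right)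
  then have "q' dvd q" using *(2) poly_coprime_dvd_mult by blast
  ultimately have deg_q: "degree q = degree q'"
    using assms(1) *(1) by (simp add: dvd_imp_degree_le antisym)
  have "degree p = degree p'"
  proof (cases "p = 0")
    case True
    then show ?thesis using *(3) assms(1) by simp
  next
    case False
    then have "p' \<noteq> 0" using *(1,3) by auto
    then show ?thesis
      using False *(1) assms(1) deg_q arg_cong[OF *(3), of degree]
      by (simp add: degree_mult_eq)
  qed
  then show "d = max (degree p) (degree q)" using d deg_q by simp
qed

section \<open>Places of \<open>k(t)\<close> over \<open>k\<close> and heights\<close>

datatype 'a place = Finite_Place 'a | Infinite_Place

text \<open>On polynomials; \<open>place_ord_poly P 0\<close> is never used.\<close>

fun place_ord_poly :: "'a::field place \<Rightarrow> 'a poly \<Rightarrow> int" where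
  "place_ord_poly (Finite_Place c) p = int (order c p)"
| "place_ord_poly Infinite_Place p = - int (degree p)"

lemma place_ord_poly_mult:
  "p \<noteq> 0 \<Longrightarrow> q \<noteq> 0 \<Longrightarrow> place_ord_poly P (p * q) = place_ord_poly P p + place_ord_poly P q"
  by (cases P) (auto simp: order_mult degree_mult_eq)

text \<open>
  The order of \<open>0\<close> is \<open>\<infinity>\<close> mathematically. Here it has the dummy value \<open>0\<close>, and
  \<open>0\<close> is left out wherever orders are compared.
\<close>

definition place_ord :: "'a::field place \<Rightarrow> 'a ratfun \<Rightarrow> int" where
  "place_ord P r = (if r = 0 then 0 else
    (THE n. \<exists>p q. p \<noteq> 0 \<and> q \<noteq> 0 \<and> r = Fract p q \<and> n = place_ord_poly P p - place_ord_poly P q))"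

lemma place_ord_Fract:
  assumes "p \<noteq> 0" "q \<noteq> 0"
  shows "place_ord P (Fract p q) = place_ord_poly P p - place_ord_poly P q"
proof -
  have nz: "Fract p q \<noteq> 0" using assms by (simp add: Zero_fract_def eq_fract)
  have "(THE n. \<exists>p' q'. p' \<noteq> 0 \<and> q' \<noteq> 0 \<and> Fract p q = Fract p' q' \<and>
      n = place_ord_poly P p' - place_ord_poly P q') = place_ord_poly P p - place_ord_poly P q"
  proof (rule the_equality)
    show "\<exists>p' q'. p' \<noteq> 0 \<and> q' \<noteq> 0 \<and> Fract p q = Fract p' q' \<and>
        place_ord_poly P p - place_ord_poly P q = place_ord_poly P p' - place_ord_poly P q'"
      using assms by blast
  next
    fix n
    assume "\<exists>p' q'. p' \<noteq> 0 \<and> q' \<noteq> 0 \<and> Fract p q = Fract p' q' \<and>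
        n = place_ord_poly P p' - place_ord_poly P q'"
    then obtain p' q' where *: "p' \<noteq> 0" "q' \<noteq> 0" "p * q' = p' * q"
        and n: "n = place_ord_poly P p' - place_ord_poly P q'"
      using assms by (auto simp: eq_fract)
    then have "place_ord_poly P p + place_ord_poly P q' = place_ord_poly P p' + place_ord_poly P q"
      using assms by (metis place_ord_poly_mult)
    then show "n = place_ord_poly P p - place_ord_poly P q" using n by simp
  qed
  then show ?thesis using nz by (simp add: place_ord_def)
qed

text \<open>
  \<open>A\<close> is the finite set of homogeneous coordinates of a projective point, so \<open>A - {0} \<noteq> {}\<close>.
  A zero coordinate contributes \<open>-\<infinity>\<close> to the maximum and is therefore omitted. The sum over
  all places is a sum over its finite support.
\<close>

definition local_height :: "'a::field ratfun set \<Rightarrow> 'a place \<Rightarrow> int" where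
  "local_height A P = (MAX a\<in>A - {0}. - place_ord P a)"

definition proj_height :: "'a::field ratfun set \<Rightarrow> int" where
  "proj_height A = (\<Sum>P | local_height A P \<noteq> 0. local_height A P)"

lemma finite_place_ord: "finite {P. place_ord P a \<noteq> 0}"
proof (cases a rule: Fract_cases_nonzero)
  case (Fract p q)
  have "{P. place_ord P a \<noteq> 0} \<subseteq>
      insert Infinite_Place (Finite_Place ` ({c. poly p c = 0} \<union> {c. poly q c = 0}))"
  proof
    fix P assume P: "P \<in> {P. place_ord P a \<noteq> 0}"
    show "P \<in> insert Infinite_Place (Finite_Place ` ({c. poly p c = 0} \<union> {c. poly q c = 0}))"
      using P Fract by (cases P) (auto simp: place_ord_Fract order_root)
  qed
  then show ?thesis
    using Fract by (rule_tac finite_subset) (auto simp: poly_roots_finite)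
next
  case 0
  then show ?thesis by (simp add: place_ord_def)
qed

lemma finite_local_height:
  assumes "finite A" "A - {0} \<noteq> {}"
  shows "finite {P. local_height A P \<noteq> 0}"
proof (rule finite_subset)
  show "{P. local_height A P \<noteq> 0} \<subseteq> (\<Union>a\<in>A. {P. place_ord P a \<noteq> 0})"
  proof
    fix P assume P: "P \<in> {P. local_height A P \<noteq> 0}"
    show "P \<in> (\<Union>a\<in>A. {P. place_ord P a \<noteq> 0})"
    proof (rule ccontr)
      assume "P \<notin> (\<Union>a\<in>A. {P. place_ord P a \<noteq> 0})"
      then have "(\<lambda>a. - place_ord P a) ` (A - {0}) = {0}" using assms(2) by auto
      then show False using P by (simp add: local_height_def)
    qed
  qed
  show "finite (\<Union>a\<in>A. {P. place_ord P a \<noteq> 0})" using assms(1) finite_place_ord by blast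
qed

section \<open>Polynomials in \<open>y, y'\<close> over \<open>k(t)\<close>\<close>

text \<open>
  \<open>k(t)[y,y']\<close> is represented as \<open>k(t)[y][y']\<close>: the outer polynomial variable is \<open>y'\<close>, and
  \<open>coeff (coeff f j) i\<close> is the coefficient of \<open>y\<^sup>i (y')\<^sup>j\<close>.
\<close>

type_synonym 'a diffpoly = "'a ratfun poly poly"

abbreviation deg_y' :: "'a::field diffpoly \<Rightarrow> nat" where
  "deg_y' f \<equiv> degree f"

definition deg_y :: "'a::field diffpoly \<Rightarrow> nat" where
  "deg_y f = (MAX j\<in>{..degree f}. degree (coeff f j))"

definition monomials :: "'a::field diffpoly \<Rightarrow> (nat \<times> nat) set" where
  "monomials f = {(i, j). coeff (coeff f j) i \<noteq> 0}"

lemma finite_monomials: "finite (monomials f)"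
proof (rule finite_subset)
  show "monomials f \<subseteq> (\<lambda>(j, i). (i, j)) ` (SIGMA j:{..degree f}. {..degree (coeff f j)})"
  proof clarify
    fix i j assume "(i, j) \<in> monomials f"
    then have *: "coeff (coeff f j) i \<noteq> 0" by (simp add: monomials_def)
    then have "coeff f j \<noteq> 0" by auto
    with * show "(i, j) \<in> (\<lambda>(j, i). (i, j)) ` (SIGMA j:{..degree f}. {..degree (coeff f j)})"
      by (auto simp: image_iff intro!: bexI[of _ "(j, i)"] le_degree)
  qed
qed auto

definition tdeg :: "'a::field diffpoly \<Rightarrow> nat" where
  "tdeg f = (MAX (i, j)\<in>monomials f. i + j)"

definition diffpoly_height :: "'a::field diffpoly \<Rightarrow> int" where
  "diffpoly_height f =
    (if card (monomials f) = 1 then 0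
     else proj_height ((\<lambda>(i, j). coeff (coeff f j) i) ` monomials f))"

definition rational_solution :: "'a::field diffpoly \<Rightarrow> 'a ratfun \<Rightarrow> bool" where
  "rational_solution f r \<longleftrightarrow> poly (poly f [:ratfun_deriv r:]) r = 0"

end

theory Submission
  imports Defs "HOL-Library.Groups_Big_Fun"
begin

text \<open>
  Comparison of the heights of the two coordinates of a point \<open>(a, b)\<close> of the curve \<open>f(x, w) = 0\<close>
  over \<open>k(t)\<close>, with \<open>n = deg\<^sub>x f\<close> and \<open>m = deg\<^sub>w f\<close>. Counting dimensions as in Runge's method
  gives \<open>W \<noteq> 0\<close> with \<open>f W = T + w\<^sup>L S\<close>, where \<open>S\<close> and \<open>T\<close> have \<open>w\<close>-degree less than \<open>m\<close> and
  \<open>L = m Q + m - 1\<close>. On the curve \<open>S = - w\<^sup>-\<^sup>L T\<close>, so \<open>S\<close> has order at most \<open>n (Q + 1)\<close> along the poles of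
  \<open>x\<close> and vanishes to order \<open>m Q\<close> along the poles of \<open>w\<close>. If \<open>S(a, b) \<noteq> 0\<close>, the product formula yields
  \<open>m Q h(b) \<le> n (Q + 1) h(a) + O(h(f))\<close>. If \<open>S(a, b) = 0\<close>, then eliminating \<open>w\<close> from \<open>f\<close> and \<open>S\<close>, which
  are coprime, bounds \<open>h(a)\<close> by a multiple of \<open>h(f)\<close>. A solution \<open>r\<close> satisfies
  \<open>h(r) - 1 \<le> h(r') \<le> 2 h(r)\<close>; applied to \<open>(r, r')\<close> or \<open>(r', r)\<close> with \<open>Q\<close> large, the comparison
  contradicts one of these inequalities unless \<open>h(r)\<close> is small.
\<close>

section \<open>Unique factorization over \<open>k(t)\<close>\<close>

text \<open>The trivial Euclidean structure of a field, in which every nonzero element is a unit. It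
  turns \<open>k(t)[y][y']\<close> into a factorial ring, so that an irreducible \<open>f\<close> is
  prime.\<close>

instantiation fract :: (idom)
  "{unique_euclidean_ring, normalization_euclidean_semiring, normalization_semidom_multiplicative}"
begin

definition [simp]: "normalize (x :: 'a fract) = (if x = 0 then 0 else 1)"
definition [simp]: "unit_factor (x :: 'a fract) = x"
definition [simp]: "x mod (y :: 'a fract) = (if y = 0 then x else 0)"
definition [simp]: "euclidean_size (x :: 'a fract) = (if x = 0 then 0 else 1 :: nat)"
definition [simp]: "division_segment (x :: 'a fract) = 1"

instance
  by standard (simp_all add: dvd_field_iff field_split_simps split: if_splits)

end

instantiation fract :: (idom) euclidean_ring_gcd
begin

definition gcd_fract :: "'a fract \<Rightarrow> 'a fract \<Rightarrow> 'a fract" where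
  "gcd_fract = Euclidean_Algorithm.gcd"
definition lcm_fract :: "'a fract \<Rightarrow> 'a fract \<Rightarrow> 'a fract" where
  "lcm_fract = Euclidean_Algorithm.lcm"
definition Gcd_fract :: "'a fract set \<Rightarrow> 'a fract" where
  "Gcd_fract = Euclidean_Algorithm.Gcd"
definition Lcm_fract :: "'a fract set \<Rightarrow> 'a fract" where
  "Lcm_fract = Euclidean_Algorithm.Lcm"

instance by standard (simp_all add: gcd_fract_def lcm_fract_def Gcd_fract_def Lcm_fract_def)

end

instance fract :: (idom) field_gcd ..

section \<open>Orders, poles and heights\<close>

lemma Sum_any_mono:
  fixes g h :: "'b \<Rightarrow> int"
  assumes "finite {x. g x \<noteq> 0}" "finite {x. h x \<noteq> 0}" "\<And>x. g x \<le> h x"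
  shows "Sum_any g \<le> Sum_any h"
proof -
  let ?S = "{x. g x \<noteq> 0} \<union> {x. h x \<noteq> 0}"
  have "Sum_any g = sum g ?S" "Sum_any h = sum h ?S"
    using assms by (auto intro!: Sum_any.expand_superset)
  with assms(3) show ?thesis by (simp add: sum_mono)
qed

lemma Fract_pair_cases:
  fixes x y :: "'a::idom fract"
  obtains a b d where "d \<noteq> 0" "x = Fract a d" "y = Fract b d"
proof -
  obtain a q where x: "x = Fract a q" "q \<noteq> 0" by (cases x)
  obtain b s where y: "y = Fract b s" "s \<noteq> 0" by (cases y)
  have "x = Fract (a * s) (q * s)" "y = Fract (b * q) (q * s)"
    using x y by (simp_all add: eq_fract)
  then show ?thesis using that x(2) y(2) by (metis mult_eq_0_iff)
qed

lemma place_ord_0 [simp]: "place_ord P 0 = 0"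
  by (simp add: place_ord_def)

lemma place_ord_1 [simp]: "place_ord P 1 = 0"
  using place_ord_Fract[of 1 1 P] by (simp add: One_fract_def)

lemma place_ord_mult:
  assumes "x \<noteq> 0" "y \<noteq> 0"
  shows "place_ord P (x * y) = place_ord P x + place_ord P y"
proof -
  obtain a b where x: "x = Fract a b" "b \<noteq> 0" by (cases x)
  obtain c d where y: "y = Fract c d" "d \<noteq> 0" by (cases y)
  have "a \<noteq> 0" "c \<noteq> 0" using assms x y by (auto simp: fract_collapse)
  with x y show ?thesis by (simp add: place_ord_Fract place_ord_poly_mult)
qed

lemma place_ord_uminus [simp]: "place_ord P (- x) = place_ord P x"
proof (cases "x = 0")
  case False
  have "2 * place_ord P (- 1) = place_ord P ((- 1) * (- 1))"
    by (subst place_ord_mult) simp_all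
  then have "place_ord P (- 1) = 0" by simp
  with False show ?thesis using place_ord_mult[of "- 1" x P] by simp
qed simp

lemma place_ord_power: "x \<noteq> 0 \<Longrightarrow> place_ord P (x ^ n) = int n * place_ord P x"
  by (induction n) (simp_all add: place_ord_mult algebra_simps)

lemma place_ord_poly_add:
  assumes "p \<noteq> 0" "q \<noteq> 0" "p + q \<noteq> 0"
  shows "min (place_ord_poly P p) (place_ord_poly P q) \<le> place_ord_poly P (p + q)"
proof (cases P)
  case (Finite_Place c)
  let ?n = "min (order c p) (order c q)"
  have "[:-c, 1:] ^ ?n dvd p" "[:-c, 1:] ^ ?n dvd q"
    using assms by (simp_all add: order_divides)
  then have "[:-c, 1:] ^ ?n dvd p + q" by (rule dvd_add)
  with assms(3) have "?n \<le> order c (p + q)" by (simp add: order_divides)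
  with Finite_Place show ?thesis by simp
next
  case Infinite_Place
  then show ?thesis using degree_add_le_max[of p q] by simp
qed

text \<open>The order of \<open>0\<close> being \<open>\<infinity>\<close>, the element \<open>0\<close> satisfies every bound.\<close>

definition pole_le :: "'a::field place \<Rightarrow> int \<Rightarrow> 'a ratfun \<Rightarrow> bool" where
  "pole_le P M x \<longleftrightarrow> x = 0 \<or> - place_ord P x \<le> M"

lemma pole_le_0 [simp]: "pole_le P M 0"
  by (simp add: pole_le_def)

lemma pole_le_1 [simp]: "0 \<le> M \<Longrightarrow> pole_le P M 1"
  by (simp add: pole_le_def)

lemma pole_le_mono: "pole_le P M x \<Longrightarrow> M \<le> N \<Longrightarrow> pole_le P N x"
  by (auto simp: pole_le_def)

lemma pole_le_uminus [simp]: "pole_le P M (- x) \<longleftrightarrow> pole_le P M x"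
  by (simp add: pole_le_def)

lemma pole_le_mult: "pole_le P M x \<Longrightarrow> pole_le P N y \<Longrightarrow> pole_le P (M + N) (x * y)"
  by (cases "x = 0 \<or> y = 0") (auto simp: pole_le_def place_ord_mult)

text \<open>The ultrametric inequality; a common denominator reduces it to polynomials. Since
  \<open>pole_le\<close> accepts \<open>0\<close>, sums with cancellation are covered too.\<close>

lemma pole_le_add:
  assumes "pole_le P M x" "pole_le P M y"
  shows "pole_le P M (x + y)"
proof (cases "x = 0 \<or> y = 0 \<or> x + y = 0")
  case True
  with assms show ?thesis by auto
next
  case False
  obtain a b d where *: "d \<noteq> 0" "x = Fract a d" "y = Fract b d" by (rule Fract_pair_cases)
  then have xy: "x + y = Fract (a + b) d"
    by (simp add: eq_fract algebra_simps)
  have nz: "a \<noteq> 0" "b \<noteq> 0" "a + b \<noteq> 0" using False * xy by (auto simp: fract_collapse)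
  then have "place_ord P (x + y) = place_ord_poly P (a + b) - place_ord_poly P d"
    using *(1) unfolding xy by (intro place_ord_Fract)
  then have "min (place_ord P x) (place_ord P y) \<le> place_ord P (x + y)"
    using place_ord_poly_add[OF nz, of P] nz *
    by (simp add: place_ord_Fract min_def split: if_splits)
  with assms False show ?thesis by (auto simp: pole_le_def)
qed

lemma pole_le_diff: "pole_le P M x \<Longrightarrow> pole_le P M y \<Longrightarrow> pole_le P M (x - y)"
  using pole_le_add[of P M x "- y"] by simp

lemma pole_le_sum: "(\<And>i. i \<in> A \<Longrightarrow> pole_le P M (g i)) \<Longrightarrow> pole_le P M (sum g A)"
  by (induction A rule: infinite_finite_induct) (auto intro: pole_le_add)

text \<open>Since \<open>place_ord P 0\<close> is \<open>0\<close>, this is \<open>0\<close> at \<open>x = 0\<close>, as the height requires.\<close>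

definition pole :: "'a::field place \<Rightarrow> 'a ratfun \<Rightarrow> int" where
  "pole P x = max 0 (- place_ord P x)"

lemma pole_nonneg [simp]: "0 \<le> pole P x"
  by (simp add: pole_def)

lemma pole_le_pole_power: "pole_le P (int n * pole P x) (x ^ n)"
proof (cases "x = 0")
  case True
  then show ?thesis by (cases n) simp_all
next
  case False
  have "int n * (- place_ord P x) \<le> int n * pole P x"
    by (intro mult_left_mono) (simp_all add: pole_def)
  with False show ?thesis by (simp add: pole_le_def place_ord_power)
qed

lemma finite_pole: "finite {P. pole P x \<noteq> 0}"
  by (rule finite_subset[OF _ finite_place_ord[of x]]) (auto simp: pole_def)

section \<open>The product formula\<close>

text \<open>The polynomial splits into linear factors, so \<open>proots p\<close> is the multiset of
  its factorization, whose size is the degree.\<close>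

lemma sum_order_eq_degree:
  fixes p :: "'a::alg_closed_field poly"
  assumes "p \<noteq> 0"
  shows "(\<Sum>c | poly p c = 0. order c p) = degree p"
proof -
  obtain A where A: "size A = degree p" "p = smult (lead_coeff p) (\<Prod>x\<in>#A. [:-x, 1:])"
    using alg_closed_imp_factorization[OF assms] by blast
  have "proots p = proots (\<Prod>x\<in>#A. [:-x, 1:])"
    using assms by (subst A(2)) (simp only: proots_smult leading_coeff_0_iff not_False_eq_True)
  also have "\<dots> = A"
  proof (induction A)
    case (add x A)
    have "(\<Prod>x\<in>#A. [:-x, 1:]) \<noteq> 0" by (auto simp: prod_mset_zero_iff)
    with add show ?case by (simp add: proots_mult del: mult_pCons_left)
  qed simp
  finally have "size (proots p) = degree p" using A(1) by simp
  then show ?thesis using assms by (simp add: size_multiset_overloaded_eq)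
qed

text \<open>Reduces a sum over places to the roots of numerator and denominator plus the point at
  infinity; \<open>S\<close> only has to contain the finite part of the support.\<close>

lemma Sum_any_place:
  assumes "finite S" "\<And>c. g (Finite_Place c) \<noteq> 0 \<Longrightarrow> c \<in> S"
  shows "Sum_any (\<lambda>P. g P) = (\<Sum>c\<in>S. g (Finite_Place c)) + (g Infinite_Place :: int)"
proof -
  have "{P. g P \<noteq> 0} \<subseteq> insert Infinite_Place (Finite_Place ` S)"
  proof
    fix P assume "P \<in> {P. g P \<noteq> 0}"
    with assms(2) show "P \<in> insert Infinite_Place (Finite_Place ` S)" by (cases P) auto
  qed
  with assms(1) have "Sum_any (\<lambda>P. g P) = (\<Sum>P\<in>insert Infinite_Place (Finite_Place ` S). g P)"
    by (intro Sum_any.expand_superset) auto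
  also have "\<dots> = g Infinite_Place + (\<Sum>P\<in>Finite_Place ` S. g P)"
    using assms(1) by (subst sum.insert) auto
  also have "(\<Sum>P\<in>Finite_Place ` S. g P) = (\<Sum>c\<in>S. g (Finite_Place c))"
    by (subst sum.reindex) (auto simp: inj_on_def)
  finally show ?thesis by simp
qed

lemma sum_order_superset:
  fixes p :: "'a::alg_closed_field poly"
  assumes "p \<noteq> 0" "finite S" "{c. poly p c = 0} \<subseteq> S"
  shows "(\<Sum>c\<in>S. int (order c p)) = int (degree p)"
proof -
  have "(\<Sum>c\<in>S. int (order c p)) = (\<Sum>c | poly p c = 0. int (order c p))"
    using assms by (intro sum.mono_neutral_right) (auto simp: order_root)
  then show ?thesis using sum_order_eq_degree[OF assms(1)] by (simp flip: of_nat_sum)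
qed

text \<open>At the finite points the orders of \<open>p / q\<close> add up to
  \<open>deg p - deg q\<close>, and the order at infinity is the negative of this.\<close>

lemma product_formula:
  fixes x :: "'a::alg_closed_field ratfun"
  shows "Sum_any (\<lambda>P. place_ord P x) = 0"
proof (cases x rule: Fract_cases_nonzero)
  case (Fract p q)
  let ?S = "{c. poly p c = 0} \<union> {c. poly q c = 0}"
  have fin: "finite ?S" using Fract by (simp add: poly_roots_finite)
  have "Sum_any (\<lambda>P. place_ord P x) =
      (\<Sum>c\<in>?S. place_ord (Finite_Place c) x) + place_ord Infinite_Place x"
    using fin Fract by (intro Sum_any_place) (auto simp: place_ord_Fract order_root)
  also have "\<dots> = 0"
    using Fract fin by (simp add: place_ord_Fract sum_subtractf sum_order_superset)
  finally show ?thesis .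
qed simp

lemma coprime_poly_nonzero:
  fixes p q :: "'a::field poly"
  assumes "coprime p q" "poly q c = 0"
  shows "poly p c \<noteq> 0"
proof
  assume "poly p c = 0"
  with assms(2) have "[:-c, 1:] dvd p" "[:-c, 1:] dvd q" by (simp_all add: poly_eq_0_iff_dvd)
  with assms(1) have "is_unit [:-c, 1:]" by (rule coprime_common_divisor)
  then show False by (simp add: is_unit_iff_degree)
qed

section \<open>Heights of a rational function and of its derivative\<close>

text \<open>This is the height of the projective point \<open>(1 : x)\<close>; its coordinate
  \<open>1\<close> contributes the \<open>0\<close> in the maximum defining
  \<open>pole\<close>.\<close>

definition height :: "'a::field ratfun \<Rightarrow> int" where
  "height x = Sum_any (\<lambda>P. pole P x)"

text \<open>In lowest terms the finite poles are the roots of \<open>q\<close> with their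
  multiplicities and contribute \<open>deg q\<close>; infinity adds
  \<open>max 0 (deg p - deg q)\<close>.\<close>

lemma height_eq_degree:
  fixes r :: "'a::alg_closed_field ratfun"
  shows "height r = int (ratfun_degree r)"
proof -
  obtain p q where r: "q \<noteq> 0" "coprime p q" "r = Fract p q" by (rule ratfun_coprime_cases)
  show ?thesis
  proof (cases "p = 0")
    case True
    with r have "degree q = 0" by (simp add: is_unit_iff_degree)
    with True r ratfun_degree_Fract[of q 0] show ?thesis
      by (simp add: height_def pole_def fract_collapse)
  next
    case False
    have *: "pole (Finite_Place c) r = int (order c q)" for c
    proof (cases "poly q c = 0")
      case True
      then have "poly p c \<noteq> 0" by (rule coprime_poly_nonzero[OF r(2)])
      then show ?thesis using False r(1,3) by (simp add: pole_def place_ord_Fract order_0I)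
    next
      case f: False
      then show ?thesis using False r(1,3) by (simp add: pole_def place_ord_Fract order_0I)
    qed
    have fin: "finite {c. poly q c = 0}" using r(1) by (simp add: poly_roots_finite)
    have "height r = (\<Sum>c | poly q c = 0. pole (Finite_Place c) r) + pole Infinite_Place r"
      unfolding height_def using fin r(1) * by (intro Sum_any_place) (auto simp: order_root)
    also have "\<dots> = int (degree q) + pole Infinite_Place r"
      using fin r(1) by (simp add: * sum_order_superset)
    also have "\<dots> = int (max (degree p) (degree q))"
      using False r(1,3) by (auto simp: pole_def place_ord_Fract)
    finally show ?thesis using r by (simp add: ratfun_degree_Fract)
  qed
qed

lemma height_nonneg: "0 \<le> height x"
  unfolding height_def using Sum_any_mono[of "\<lambda>_. 0" "\<lambda>P. pole P x"] by (simp add: finite_pole)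

lemma ratfun_degree_Fract_le:
  assumes "q \<noteq> 0"
  shows "ratfun_degree (Fract p q) \<le> max (degree p) (degree q)"
proof -
  obtain p' q' where *: "q' \<noteq> 0" "coprime p' q'" "Fract p q = Fract p' q'"
    by (rule ratfun_coprime_cases)
  with assms have eq: "p * q' = p' * q" by (simp add: eq_fract)
  then have "q' dvd p' * q" by (metis dvd_triv_right)
  then have "q' dvd q" using *(2) poly_coprime_dvd_mult by blast
  then obtain g where g: "q = q' * g" by (elim dvdE)
  with eq *(1) have p: "p = p' * g" by (simp add: ac_simps)
  have "g \<noteq> 0" using g assms by auto
  then have "degree p' \<le> degree p" "degree q' \<le> degree q"
    using *(1) unfolding g p by (cases "p' = 0"; simp add: degree_mult_eq)+
  then show ?thesis unfolding *(3) ratfun_degree_Fract[OF *(1,2)] by linarith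
qed

text \<open>By the quotient rule numerator and denominator have at most twice the degree, and
  cancellation only lowers it.\<close>

lemma ratfun_degree_deriv_le:
  fixes r :: "'a::field_char_0 ratfun"
  shows "ratfun_degree (ratfun_deriv r) \<le> 2 * ratfun_degree r"
proof -
  obtain p q where r: "q \<noteq> 0" "coprime p q" "r = Fract p q" by (rule ratfun_coprime_cases)
  let ?n = "max (degree p) (degree q)"
  have "degree (pderiv p * q - p * pderiv q) \<le> 2 * ?n"
  proof (rule degree_diff_le)
    show "degree (pderiv p * q) \<le> 2 * ?n"
      using degree_mult_le[of "pderiv p" q] degree_pderiv[of p] by linarith
    show "degree (p * pderiv q) \<le> 2 * ?n"
      using degree_mult_le[of p "pderiv q"] degree_pderiv[of q] by linarith
  qed
  moreover have "degree (q ^ 2) \<le> 2 * ?n" using degree_power_le[of q 2] by linarith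
  ultimately have "ratfun_degree (ratfun_deriv r) \<le> 2 * ?n"
    using ratfun_degree_Fract_le[of "q ^ 2" "pderiv p * q - p * pderiv q"] r(1,3)
    by (simp add: ratfun_deriv_Fract)
  with r show ?thesis by (simp add: ratfun_degree_Fract)
qed

text \<open>In characteristic zero differentiation raises the order of a finite pole and lowers that
  of a pole at infinity by at most one, which explains the correction term.\<close>

lemma pole_ratfun_deriv:
  fixes r :: "'a::field_char_0 ratfun"
  shows "pole P r \<le> pole P (ratfun_deriv r) + (if P = Infinite_Place then 1 else 0)"
proof (cases "pole P r = 0")
  case False
  then have pos: "pole P r > 0" using pole_nonneg[of P r] by linarith
  obtain p q where r: "q \<noteq> 0" "coprime p q" "r = Fract p q" by (rule ratfun_coprime_cases)
  have p0: "p \<noteq> 0" using pos r(3) by (auto simp: pole_def fract_collapse)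
  let ?N = "pderiv p * q - p * pderiv q"
  have r': "ratfun_deriv r = Fract ?N (q ^ 2)" using r by (simp add: ratfun_deriv_Fract)
  show ?thesis
  proof (cases P)
    case (Finite_Place c)
    have "order c q > 0" using pos p0 r Finite_Place by (auto simp: pole_def place_ord_Fract)
    then have qc: "poly q c = 0" using r(1) by (simp add: order_root)
    then have pc: "poly p c \<noteq> 0" by (rule coprime_poly_nonzero[OF r(2)])
    have oq: "order c q = Suc (order c (pderiv q))" using order_pderiv[OF r(1) qc] .
    have "degree q \<noteq> 0"
    proof
      assume "degree q = 0"
      then obtain e where "q = [:e:]" by (rule degree_eq_zeroE)
      with qc r(1) show False by simp
    qed
    then have "pderiv q \<noteq> 0" by (simp add: pderiv_eq_0_iff)
    \<comment> \<open>At \<open>c\<close> the product \<open>p * pderiv q\<close> vanishes to one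
      order less than \<open>q\<close>, but \<open>pderiv p * q\<close> at least to the order of
      \<open>q\<close>; so \<open>?N\<close> vanishes to a lower order than
      \<open>q\<close>.\<close>
    then have "\<not> [:-c, 1:] ^ order c q dvd p * pderiv q"
      using oq p0 pc by (subst order_divides) (simp add: order_mult order_0I)
    moreover have "[:-c, 1:] ^ order c q dvd pderiv p * q" by (simp add: order_1)
    ultimately have "\<not> [:-c, 1:] ^ order c q dvd ?N" by (simp add: dvd_diff_right_iff)
    then have N: "?N \<noteq> 0" "order c ?N < order c q" by (auto simp: order_divides)
    have "place_ord P (ratfun_deriv r) = int (order c ?N) - 2 * int (order c q)"
      unfolding r' using N(1) r(1) Finite_Place
      by (simp add: place_ord_Fract power2_eq_square order_mult)
    moreover have "place_ord P r = - int (order c q)"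
      unfolding r(3) using p0 pc r(1) Finite_Place by (simp add: place_ord_Fract order_0I)
    ultimately show ?thesis using N(2) Finite_Place by (simp add: pole_def)
  next
    case Infinite_Place
    then have dpq: "degree q < degree p" using pos p0 r by (auto simp: pole_def place_ord_Fract)
    define dp dq where "dp = degree p" and "dq = degree q"
    \<comment> \<open>In the top degree \<open>dp + dq - 1\<close> the two products carry the
      factors \<open>dp\<close> and \<open>dq\<close>, which stay different in characteristic
      zero.\<close>
    have 1: "coeff (pderiv p * q) (dp - 1 + dq) = of_nat dp * lead_coeff p * lead_coeff q"
      using coeff_mult_degree_sum[of "pderiv p" q] dpq
      by (simp add: degree_pderiv coeff_pderiv dp_def dq_def)
    have 2: "coeff (p * pderiv q) (dp - 1 + dq) = of_nat dq * lead_coeff p * lead_coeff q"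
    \<comment> \<open>For constant \<open>q\<close> the degree of \<open>pderiv q\<close> is
      \<open>0\<close> and not \<open>dq - 1\<close>, hence the separate case.\<close>
    proof (cases "dq = 0")
      case True
      then have "pderiv q = 0" by (simp add: pderiv_eq_0_iff dq_def)
      with True show ?thesis by simp
    next
      case False
      then have "dp - 1 + dq = degree p + degree (pderiv q)" using dpq
        by (simp add: degree_pderiv dp_def dq_def)
      with False show ?thesis using coeff_mult_degree_sum[of p "pderiv q"]
        by (simp add: degree_pderiv coeff_pderiv dp_def dq_def)
    qed
    have "coeff ?N (dp - 1 + dq) = (of_nat dp - of_nat dq) * (lead_coeff p * lead_coeff q)"
      using 1 2 by (simp add: algebra_simps)
    moreover have "(of_nat dp :: 'a) \<noteq> of_nat dq" using dpq by (simp add: dp_def dq_def)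
    ultimately have "coeff ?N (dp - 1 + dq) \<noteq> 0" using p0 r(1) by simp
    then have "?N \<noteq> 0" "dp - 1 + dq \<le> degree ?N" by (auto intro: le_degree)
    then have "place_ord P (ratfun_deriv r) \<le> int dq - int dp + 1"
      unfolding r' using Infinite_Place r(1) dpq
      by (simp add: place_ord_Fract degree_power_eq dp_def dq_def)
    moreover have "place_ord P r = int dq - int dp"
      unfolding r(3) using p0 r(1) Infinite_Place by (simp add: place_ord_Fract dp_def dq_def)
    ultimately show ?thesis using Infinite_Place by (simp add: pole_def)
  qed
qed simp

lemma height_le_height_deriv:
  fixes r :: "'a::{alg_closed_field, field_char_0} ratfun"
  shows "height r \<le> height (ratfun_deriv r) + 1"
proof -
  let ?g = "\<lambda>P. if P = Infinite_Place then 1 else 0 :: int"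
  have fin: "finite {P. ?g P \<noteq> 0}" by simp
  have "{P. pole P (ratfun_deriv r) + ?g P \<noteq> 0} \<subseteq> {P. pole P (ratfun_deriv r) \<noteq> 0} \<union> {P. ?g P \<noteq> 0}"
    by auto
  then have "finite {P. pole P (ratfun_deriv r) + ?g P \<noteq> 0}"
    by (rule finite_subset) (use finite_pole fin in blast)
  then have "height r \<le> Sum_any (\<lambda>P. pole P (ratfun_deriv r) + ?g P)"
    unfolding height_def by (intro Sum_any_mono finite_pole pole_ratfun_deriv)
  also have "\<dots> = height (ratfun_deriv r) + Sum_any (\<lambda>P. ?g P)"
    unfolding height_def
    using finite_pole[of "ratfun_deriv r"] by (subst Sum_any.distrib) (simp_all del: Sum_any.cong)
  also have "Sum_any (\<lambda>P. ?g P) = 1" by (subst Sum_any_place[of "{}"]) (auto split: if_splits)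
  finally show ?thesis .
qed

section \<open>Small solutions of linear systems\<close>

text \<open>
  Fraction-free Gaussian elimination doubles the local bound at each step. This exponential growth
  is affordable here and avoids minors.
\<close>

lemma linear_system_small_solution:
  fixes c :: "'e \<Rightarrow> 'i \<Rightarrow> 'a::field ratfun" and M :: "'a place \<Rightarrow> int"
  assumes "finite E" "finite I" "card E < card I" "\<And>P. 0 \<le> M P"
    and "\<And>P e i. e \<in> E \<Longrightarrow> i \<in> I \<Longrightarrow> pole_le P (M P) (c e i)"
  shows "\<exists>u. (\<exists>i\<in>I. u i \<noteq> 0) \<and> (\<forall>e\<in>E. (\<Sum>i\<in>I. c e i * u i) = 0) \<and>
    (\<forall>P. \<forall>i\<in>I. pole_le P ((2 ^ card E - 1) * M P) (u i))"
  using assms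
proof (induction E arbitrary: I c M rule: finite_induct)
  case empty
  then have "I \<noteq> {}" by auto
  then show ?case by (intro exI[of _ "\<lambda>_. 1"]) auto
next
  case (insert e0 E)
  have card: "card (insert e0 E) = Suc (card E)" using insert.hyps by simp
  show ?case
  proof (cases "\<forall>i\<in>I. c e0 i = 0")
    case True
    have "card E < card I" using insert.prems(2) card by simp
    then obtain u where u: "\<exists>i\<in>I. u i \<noteq> 0" "\<forall>e\<in>E. (\<Sum>i\<in>I. c e i * u i) = 0"
        "\<forall>P. \<forall>i\<in>I. pole_le P ((2 ^ card E - 1) * M P) (u i)"
      using insert.IH[of I M c] insert.prems by blast
    have "(2 ^ card E - 1) * M P \<le> (2 ^ Suc (card E) - 1) * M P" for P
      using insert.prems(3)[of P]
      by (intro mult_right_mono diff_right_mono power_increasing) auto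
    then have "\<forall>P. \<forall>i\<in>I. pole_le P ((2 ^ Suc (card E) - 1) * M P) (u i)"
      using u(3) pole_le_mono by blast
    with u(1,2) True show ?thesis unfolding card by (intro exI[of _ u]) auto
  next
    case False
    then obtain i0 where i0: "i0 \<in> I" "c e0 i0 \<noteq> 0" by blast
    \<comment> \<open>Cross-multiplication with the pivot \<open>c e0 i0\<close> removes the unknown
      \<open>i0\<close> without division, at the price of doubling the local bound.\<close>
    define c' where "c' e i = c e0 i0 * c e i - c e i0 * c e0 i" for e i
    let ?J = "I - {i0}"
    have J: "finite ?J" "card E < card ?J"
      using insert.prems(1,2) card i0(1) by auto
    have c': "pole_le P (2 * M P) (c' e i)" if "e \<in> E" "i \<in> ?J" for P e i
    proof -
      have "pole_le P (M P + M P) (c' e i)"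
        unfolding c'_def using that i0(1) insert.prems(4)
        by (intro pole_le_diff pole_le_mult) auto
      then show ?thesis by simp
    qed
    have "\<exists>u. (\<exists>i\<in>?J. u i \<noteq> 0) \<and> (\<forall>e\<in>E. (\<Sum>i\<in>?J. c' e i * u i) = 0) \<and>
        (\<forall>P. \<forall>i\<in>?J. pole_le P ((2 ^ card E - 1) * (2 * M P)) (u i))"
      using insert.prems(3) c' by (intro insert.IH J) simp_all
    then obtain u where u: "\<exists>i\<in>?J. u i \<noteq> 0"
        "\<And>e. e \<in> E \<Longrightarrow> (\<Sum>i\<in>?J. c' e i * u i) = 0"
        "\<And>P i. i \<in> ?J \<Longrightarrow> pole_le P ((2 ^ card E - 1) * (2 * M P)) (u i)"
      by blast
    \<comment> \<open>Back substitution: all other unknowns are scaled by the pivot, so that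
      \<open>e0\<close> determines the value at \<open>i0\<close> without division.\<close>
    define v where "v i = (if i = i0 then - (\<Sum>i\<in>?J. c e0 i * u i) else c e0 i0 * u i)" for i
    have sum_v: "(\<Sum>i\<in>I. c e i * v i) = (\<Sum>i\<in>?J. c' e i * u i)" for e
    proof -
      have "(\<Sum>i\<in>I. c e i * v i) = c e i0 * v i0 + (\<Sum>i\<in>?J. c e i * v i)"
        using insert.prems(1) i0(1) by (rule sum.remove)
      also have "(\<Sum>i\<in>?J. c e i * v i) = (\<Sum>i\<in>?J. c e0 i0 * c e i * u i)"
        by (intro sum.cong) (auto simp: v_def)
      also have "c e i0 * v i0 = - (\<Sum>i\<in>?J. c e i0 * c e0 i * u i)"
        by (simp add: v_def sum_distrib_left mult.assoc)
      also have "- (\<Sum>i\<in>?J. c e i0 * c e0 i * u i) + (\<Sum>i\<in>?J. c e0 i0 * c e i * u i) =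
          (\<Sum>i\<in>?J. c' e i * u i)"
        by (simp add: c'_def left_diff_distrib sum_subtractf)
      finally show ?thesis .
    qed
    have "c' e0 i = 0" for i by (simp add: c'_def)
    then have "\<forall>e\<in>insert e0 E. (\<Sum>i\<in>I. c e i * v i) = 0"
      using u(2) by (auto simp: sum_v)
    moreover have "\<exists>i\<in>I. v i \<noteq> 0" using u(1) i0(2) by (auto simp: v_def)
    moreover have "pole_le P ((2 ^ Suc (card E) - 1) * M P) (v i)" if "i \<in> I" for P i
    proof -
      have eq: "(2 ^ Suc (card E) - 1) * M P = M P + (2 ^ card E - 1) * (2 * M P)"
        by (simp add: algebra_simps)
      show ?thesis unfolding eq v_def using i0(1) that
        by (auto intro!: pole_le_sum pole_le_mult u(3) insert.prems(4))
    qed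
    ultimately show ?thesis unfolding card by blast
  qed
qed

text \<open>Each position in \<open>Z\<close> is one linear equation for the multipliers
  \<open>u\<close>. The factor \<open>2 ^ card Z\<close> is \<open>2 ^ card Z - 1\<close> from the
  size of \<open>u\<close> plus one for the coefficients of \<open>g\<close>.\<close>

lemma bivariate_combination:
  fixes g :: "'i \<Rightarrow> 'a::field diffpoly" and M :: "'a place \<Rightarrow> int"
  assumes "finite Z" "finite I" "card Z < card I" "\<And>P. 0 \<le> M P"
    and "\<And>P i j k. i \<in> I \<Longrightarrow> pole_le P (M P) (coeff (coeff (g i) j) k)"
  obtains u where "\<exists>i\<in>I. u i \<noteq> 0"
    "\<And>j k. (j, k) \<in> Z \<Longrightarrow> coeff (coeff (\<Sum>i\<in>I. smult [:u i:] (g i)) j) k = 0"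
    "\<And>P j k. pole_le P (2 ^ card Z * M P) (coeff (coeff (\<Sum>i\<in>I. smult [:u i:] (g i)) j) k)"
proof -
  have coeff: "coeff (coeff (\<Sum>i\<in>I. smult [:u i:] (g i)) j) k = (\<Sum>i\<in>I. coeff (coeff (g i) j) k * u i)"
    for u j k
    by (simp add: coeff_sum mult.commute)
  obtain u where u: "\<exists>i\<in>I. u i \<noteq> 0"
      "\<forall>e\<in>Z. (\<Sum>i\<in>I. coeff (coeff (g i) (fst e)) (snd e) * u i) = 0"
      "\<forall>P. \<forall>i\<in>I. pole_le P ((2 ^ card Z - 1) * M P) (u i)"
    using linear_system_small_solution[OF assms(1-3), where M = M and
          c = "\<lambda>e i. coeff (coeff (g i) (fst e)) (snd e)"]
      assms(4,5) by blast
  show ?thesis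
  proof (rule that[of u])
    show "coeff (coeff (\<Sum>i\<in>I. smult [:u i:] (g i)) j) k = 0" if "(j, k) \<in> Z" for j k
      unfolding coeff using u(2) that by force
    show "pole_le P (2 ^ card Z * M P) (coeff (coeff (\<Sum>i\<in>I. smult [:u i:] (g i)) j) k)" for P j k
    proof -
      have eq: "2 ^ card Z * M P = M P + (2 ^ card Z - 1) * M P" by (simp add: algebra_simps)
      show ?thesis unfolding eq coeff using u(3) by (auto intro!: pole_le_sum pole_le_mult assms(5))
    qed
  qed (rule u(1))
qed

section \<open>Values and roots of polynomials, and polynomials with undetermined
  coefficients\<close>

lemma poly_altdef_le:
  fixes p :: "'a::comm_semiring_1 poly"
  assumes "degree p \<le> n"
  shows "poly p x = (\<Sum>i\<le>n. coeff p i * x ^ i)"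
  unfolding poly_altdef using assms by (intro sum.mono_neutral_left) (auto simp: coeff_eq_0)

abbreviation poly2 :: "'a::comm_semiring_0 poly poly \<Rightarrow> 'a \<Rightarrow> 'a \<Rightarrow> 'a" where
  "poly2 F a b \<equiv> poly (poly F [:b:]) a"

lemma poly2_altdef:
  fixes F :: "'a::comm_ring_1 poly poly"
  assumes "degree F \<le> l" "\<And>j. degree (coeff F j) \<le> d"
  shows "poly2 F a b = (\<Sum>j\<le>l. \<Sum>i\<le>d. coeff (coeff F j) i * a ^ i * b ^ j)"
proof -
  have "poly2 F a b = (\<Sum>j\<le>l. poly (coeff F j) a * b ^ j)"
    using poly_altdef_le[OF assms(1), of "[:b:]"] by (simp add: poly_sum)
  then show ?thesis by (simp add: poly_altdef_le[OF assms(2)] sum_distrib_right)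
qed

lemma pole_le_poly2:
  assumes "degree F \<le> l" "\<And>j. degree (coeff F j) \<le> d"
    and "\<And>j i. pole_le P M (coeff (coeff F j) i)"
  shows "pole_le P (M + int d * pole P a + int l * pole P b) (poly2 F a b)"
  unfolding poly2_altdef[OF assms(1,2)]
proof (intro pole_le_sum pole_le_mult assms(3))
  fix i j assume "i \<in> {..d}" "j \<in> {..l}"
  then have "int i * pole P a \<le> int d * pole P a" "int j * pole P b \<le> int l * pole P b"
    by (simp_all add: mult_right_mono)
  then show "pole_le P (int d * pole P a) (a ^ i)" "pole_le P (int l * pole P b) (b ^ j)"
    using pole_le_pole_power pole_le_mono by blast+
qed

text \<open>At a pole of \<open>a\<close> the leading term of \<open>p\<close> is balanced by the
  lower ones, so \<open>pole P a\<close> is at most \<open>G P\<close> plus the order of the leading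
  coefficient. By the product formula these orders disappear on summation.\<close>

lemma height_root_le:
  fixes p :: "'a::alg_closed_field ratfun poly"
  assumes "p \<noteq> 0" "poly p a = 0" "finite {P. G P \<noteq> 0}" "\<And>P i. pole_le P (G P) (coeff p i)"
  shows "height a \<le> Sum_any G"
proof -
  define d where "d = degree p - 1"
  have deg: "degree p = Suc d"
    using assms(1,2) by (cases "degree p") (auto simp: d_def elim!: degree_eq_zeroE)
  let ?c = "lead_coeff p"
  have c: "?c \<noteq> 0" using assms(1) by simp
  have local: "pole P a \<le> G P + place_ord P ?c" for P
  proof (cases "pole P a = 0")
    case True
    then show ?thesis using assms(4)[of P "degree p"] c by (simp add: pole_le_def)
  next
    case False
    then have a: "a \<noteq> 0" "pole P a = - place_ord P a"
      by (auto simp: pole_def max_def split: if_splits)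
    have "?c * a ^ Suc d = - (\<Sum>i\<le>d. coeff p i * a ^ i)"
      using assms(2) by (simp add: poly_altdef deg eq_neg_iff_add_eq_0 add.commute)
    moreover have "pole_le P (G P + int d * pole P a) (\<Sum>i\<le>d. coeff p i * a ^ i)"
    proof (intro pole_le_sum pole_le_mult assms(4))
      fix i assume "i \<in> {..d}"
      then have "int i * pole P a \<le> int d * pole P a" by (simp add: mult_right_mono)
      then show "pole_le P (int d * pole P a) (a ^ i)"
        using pole_le_pole_power pole_le_mono by blast
    qed
    ultimately have "pole_le P (G P + int d * pole P a) (?c * a ^ Suc d)" by simp
    then have "- place_ord P ?c + int (Suc d) * pole P a \<le> G P + int d * pole P a"
      using c a by (simp add: pole_le_def place_ord_mult place_ord_power del: power_Suc)
    then show ?thesis by (simp add: algebra_simps)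
  qed
  have fin: "finite {P. G P + place_ord P ?c \<noteq> 0}"
    by (rule finite_subset[of _ "{P. G P \<noteq> 0} \<union> {P. place_ord P ?c \<noteq> 0}"])
      (auto intro: assms(3) finite_place_ord)
  have "height a \<le> Sum_any (\<lambda>P. G P + place_ord P ?c)"
    unfolding height_def using finite_pole fin local by (rule Sum_any_mono)
  also have "\<dots> = Sum_any G + Sum_any (\<lambda>P. place_ord P ?c)"
    using assms(3) finite_place_ord by (rule Sum_any.distrib)
  finally show ?thesis by (simp add: product_formula)
qed

text \<open>The bound on \<open>j\<close> is strict so that \<open>l = 0\<close> is allowed and
  gives the zero polynomial.\<close>

definition bipoly :: "nat \<Rightarrow> nat \<Rightarrow> (nat \<times> nat \<Rightarrow> 'a::comm_ring_1) \<Rightarrow> 'a poly poly" where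
  "bipoly d l u = (\<Sum>(i, j)\<in>{..d} \<times> {..<l}. monom (monom (u (i, j)) i) j)"

lemma coeff_bipoly:
  "coeff (coeff (bipoly d l u) j) i = (if i \<le> d \<and> j < l then u (i, j) else 0)"
proof -
  have "coeff (coeff (bipoly d l u) j) i =
      (\<Sum>z\<in>{..d} \<times> {..<l}. if z = (i, j) then u z else 0)"
    unfolding bipoly_def coeff_sum by (intro sum.cong) (auto simp: coeff_monom split: if_splits)
  then show ?thesis by (simp add: sum.delta)
qed

text \<open>Exhibits a product with an undetermined factor as a linear combination in its
  coefficients, the form required by \<open>bivariate_combination\<close>.\<close>

lemma bipoly_mult:
  "bipoly d l u * F =
    (\<Sum>z\<in>{..d} \<times> {..<l}. smult [:u z:] (monom (monom 1 (fst z)) (snd z) * F))"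
  unfolding bipoly_def sum_distrib_right
  by (intro sum.cong) (auto simp: smult_monom simp flip: mult_smult_left)

lemma degree_bipoly: "0 < l \<Longrightarrow> degree (bipoly d l u) < l"
  by (intro degree_lessI) (auto simp: poly_eq_iff coeff_bipoly)

lemma degree_coeff_bipoly: "degree (coeff (bipoly d l u) j) \<le> d"
  by (intro degree_le) (auto simp: coeff_bipoly)

lemma bipoly_0: "bipoly d 0 u = 0"
  by (simp add: bipoly_def)

lemma pole_le_coeff_monom_mult:
  assumes "\<And>j i. pole_le P M (coeff (coeff F j) i)"
  shows "pole_le P M (coeff (coeff (monom (monom 1 i') j' * F) j) i)"
  using assms by (simp add: coeff_monom_mult)

lemma degree_coeff_mult_le:
  fixes F G :: "'a::comm_ring_1 poly poly"
  assumes "\<And>j. degree (coeff F j) \<le> d" "\<And>j. degree (coeff G j) \<le> e"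
  shows "degree (coeff (F * G) j) \<le> d + e"
  unfolding coeff_mult
  by (intro degree_sum_le) (auto intro!: order_trans[OF degree_mult_le] add_mono assms)

section \<open>Comparison of heights on a plane curve\<close>

text \<open>
  A nonzero combination \<open>A f + B S\<close> free of the outer variable plays the role of the resultant; it
  is found by linear algebra, and it is nonzero because \<open>f\<close> is prime and \<open>B\<close> has smaller degree.
\<close>

lemma common_zero_height_le:
  fixes f S :: "'a::alg_closed_field diffpoly"
  assumes f: "irreducible f" "degree f = m" "0 < m" and S: "\<not> f dvd S" "degree S \<le> l"
    and d: "\<And>j. degree (coeff f j) \<le> d" "\<And>j. degree (coeff S j) \<le> d"
    and G: "\<And>P. 0 \<le> G P" "finite {P. G P \<noteq> 0}"
      "\<And>P i j. pole_le P (G P) (coeff (coeff f j) i)"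
      "\<And>P i j. pole_le P (G P) (coeff (coeff S j) i)"
    and zero: "poly2 f a b = 0" "poly2 S a b = 0"
  shows "height a \<le> 2 ^ ((m + l - 1) * ((m + l) * d + 1)) * Sum_any G"
proof -
  define k where "k = m + l - 1"
  have k: "m + l = Suc k" using f(3) by (simp add: k_def)
  \<comment> \<open>With this inner degree there are \<open>(k * d + 1) * (k + 1)\<close> unknowns
    for the coefficients of \<open>A\<close> and \<open>B\<close>, exactly one more than the
    \<open>k * ((k + 1) * d + 1)\<close> equations.\<close>
  define D where "D = k * d"
  define X Y Z where "X = {..D} \<times> {..<l}" and "Y = {..D} \<times> {..<m}" and "Z = {1..k} \<times> {..D + d}"
  define g where "g z = (case z of Inl z \<Rightarrow> monom (monom 1 (fst z)) (snd z) * f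
    | Inr z \<Rightarrow> monom (monom 1 (fst z)) (snd z) * S)" for z
  have fin: "finite X" "finite Y" "finite Z" by (simp_all add: X_def Y_def Z_def)
  have card_Z: "card Z = k * (Suc k * d + 1)"
    by (simp add: Z_def D_def algebra_simps)
  have "card (X <+> Y) = (D + 1) * Suc k"
    using fin by (simp add: card_Plus X_def Y_def algebra_simps flip: k)
  then have card: "card Z < card (X <+> Y)"
    by (simp add: card_Z D_def algebra_simps)
  have g: "pole_le P (G P) (coeff (coeff (g z) j) i)" for P z i j
    by (cases z) (simp_all add: g_def pole_le_coeff_monom_mult G)
  obtain u where u: "\<exists>z\<in>X <+> Y. u z \<noteq> 0"
      "\<And>j i. (j, i) \<in> Z \<Longrightarrow> coeff (coeff (\<Sum>z\<in>X <+> Y. smult [:u z:] (g z)) j) i = 0"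
      "\<And>P j i. pole_le P (2 ^ card Z * G P) (coeff (coeff (\<Sum>z\<in>X <+> Y. smult [:u z:] (g z)) j) i)"
    by (rule bivariate_combination[OF fin(3) _ card, where g = g and M = G])
      (use fin G(1) g in auto)
  define A where "A = bipoly D l (u \<circ> Inl)"
  define B where "B = bipoly D m (u \<circ> Inr)"
  define F where "F = A * f + B * S"
  have F: "(\<Sum>z\<in>X <+> Y. smult [:u z:] (g z)) = F"
    unfolding F_def A_def B_def bipoly_mult using fin
    by (simp add: sum.Plus g_def X_def Y_def)
  have deg_B: "degree B < m" unfolding B_def using f(3) by (rule degree_bipoly)
  have deg_F: "degree F \<le> k"
    unfolding F_def
  proof (rule degree_add_le)
    show "degree (B * S) \<le> k"
      using degree_mult_le[of B S] deg_B S(2) by (simp add: k_def)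
    show "degree (A * f) \<le> k"
    proof (cases "l = 0")
      case False
      then have "degree A < l" unfolding A_def by (intro degree_bipoly) simp
      then show ?thesis using degree_mult_le[of A f] f(2) by (simp add: k_def)
    qed (simp add: A_def bipoly_0)
  qed
  have degx_F: "degree (coeff F j) \<le> D + d" for j
    unfolding F_def coeff_add A_def B_def
    by (intro degree_add_le degree_coeff_mult_le degree_coeff_bipoly d)
  have "coeff F j = 0" if "j \<noteq> 0" for j
  proof (rule poly_eqI)
    fix i
    show "coeff (coeff F j) i = coeff 0 i"
    proof (cases "j \<le> k \<and> i \<le> D + d")
      case True
      with that show ?thesis using u(2)[of j i] by (simp add: F Z_def)
    next
      case False
      then show ?thesis using deg_F degx_F[of j]
        by (metis coeff_0 coeff_eq_0 le_less_trans not_le)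
    qed
  qed
  then have F0: "F = [:coeff F 0:]"
    by (intro poly_eqI) (simp add: coeff_pCons split: nat.split)
  have "F \<noteq> 0"
  proof
    assume "F = 0"
    then have "B * S = (- A) * f" by (simp add: F_def eq_neg_iff_add_eq_0 add.commute)
    then have "f dvd B * S" by simp
    with f(1) S(1) have "f dvd B"
      by (simp add: irreducible_imp_prime_elem prime_elem_dvd_mult_iff)
    with deg_B f(2) have B0: "B = 0" using dvd_imp_degree_le[of f B] by linarith
    with \<open>F = 0\<close> f(1) have A0: "A = 0" by (auto simp: F_def)
    have "u z = 0" if "z \<in> X <+> Y" for z
    proof (cases z)
      case (Inl w)
      then show ?thesis using that arg_cong[OF A0, of "\<lambda>p. coeff (coeff p (snd w)) (fst w)"]
        by (auto simp: A_def coeff_bipoly X_def)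
    next
      case (Inr w)
      then show ?thesis using that arg_cong[OF B0, of "\<lambda>p. coeff (coeff p (snd w)) (fst w)"]
        by (auto simp: B_def coeff_bipoly Y_def)
    qed
    with u(1) show False by blast
  qed
  with F0 have nz: "coeff F 0 \<noteq> 0" by auto
  \<comment> \<open>The common zero annihilates \<open>F\<close>, which is free of the outer
    variable, so \<open>a\<close> is a root of a polynomial with controlled coefficients.\<close>
  have "poly2 F a b = 0" using zero by (simp add: F_def)
  with F0 have root: "poly (coeff F 0) a = 0" by (metis poly_const_conv)
  have "finite {P. 2 ^ card Z * G P \<noteq> 0}" using G(2) by simp
  then have "height a \<le> Sum_any (\<lambda>P. 2 ^ card Z * G P)"
    using nz root u(3)[unfolded F] by (intro height_root_le) auto
  also have "\<dots> = 2 ^ card Z * Sum_any G" by (rule Sum_any_right_distrib[OF G(2), symmetric])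
  finally show ?thesis by (simp add: card_Z k)
qed

text \<open>The coefficients of \<open>W * f\<close> at outer exponents from \<open>m\<close> to
  \<open>L - 1\<close> are made to vanish, leaving \<open>T\<close> below and \<open>S\<close> above
  the gap.\<close>

lemma exists_section:
  fixes f :: "'a::field diffpoly"
  assumes m: "degree f = m" "0 < m" and n: "\<And>j. degree (coeff f j) \<le> n" and Q: "0 < Q"
    and M: "\<And>P. 0 \<le> M P" "\<And>P i j. pole_le P (M P) (coeff (coeff f j) i)"
  defines "c \<equiv> 2 ^ ((m * Q - 1) * (n * (Q + 1) + 1)) :: int"
  obtains S where "S \<noteq> 0" "degree S < m" "\<And>j. degree (coeff S j) \<le> n * (Q + 1)"
    "\<And>P i j. pole_le P (c * M P) (coeff (coeff S j) i)"
    "\<And>P a b. poly2 f a b = 0 \<Longrightarrow>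
      pole_le P (c * M P + int (n * (Q + 1)) * pole P a - int (m * Q) * pole P b) (poly2 S a b)"
proof -
  define p where "p = n * (Q + 1)"
  obtain q where q: "m * Q = Suc q" using m(2) Q by (metis gr0_conv_Suc nat_0_less_mult_iff)
  \<comment> \<open>The gap has length \<open>q = m * Q - 1\<close>, and
    \<open>L - (m - 1) = m * Q\<close> is the order gained at the poles of \<open>b\<close>.\<close>
  define L where "L = q + m"
  \<comment> \<open>\<open>X\<close> indexes the coefficients of \<open>W\<close>, and
    \<open>Z\<close> the positions in the gap. The unknowns exceed the equations by
    \<open>n + m\<close>.\<close>
  define X Z where "X = {..n * Q} \<times> {..<L}" and "Z = {m..<L} \<times> {..p}"
  have fin: "finite X" "finite Z" by (simp_all add: X_def Z_def)
  have card_Z: "card Z = (m * Q - 1) * (n * (Q + 1) + 1)"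
    by (simp add: Z_def L_def p_def q)
  have c: "c = 2 ^ card Z" by (simp add: c_def card_Z)
  have "n * Q * m = n * (m * Q)" by (simp add: ac_simps)
  then have "n * Q * m = n * q + n" by (simp add: q)
  then have card: "card Z < card X"
    using m(2) by (simp add: Z_def X_def L_def p_def algebra_simps)
  let ?g = "\<lambda>z. monom (monom 1 (fst z)) (snd z) * f"
  have g: "pole_le P (M P) (coeff (coeff (?g z) j) i)" for P z i j
    by (intro pole_le_coeff_monom_mult M(2))
  obtain u where u: "\<exists>z\<in>X. u z \<noteq> 0"
      "\<And>j i. (j, i) \<in> Z \<Longrightarrow> coeff (coeff (\<Sum>z\<in>X. smult [:u z:] (?g z)) j) i = 0"
      "\<And>P j i. pole_le P (2 ^ card Z * M P) (coeff (coeff (\<Sum>z\<in>X. smult [:u z:] (?g z)) j) i)"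
    by (rule bivariate_combination[OF fin(2,1) card, where g = ?g and M = M])
      (use fin M(1) g in auto)
  define W where "W = bipoly (n * Q) L u"
  define F where "F = W * f"
  have F: "(\<Sum>z\<in>X. smult [:u z:] (?g z)) = F"
    unfolding F_def W_def bipoly_mult X_def ..
  define S T where "S = poly_shift L F" and "T = poly_cutoff L F"
  have L: "0 < L" using m(2) by (simp add: L_def)
  have deg_W: "degree W < L" unfolding W_def using L by (rule degree_bipoly)
  have deg_F: "degree F < L + m" using degree_mult_le[of W f] deg_W m(1) by (simp add: F_def)
  have degx_F: "degree (coeff F j) \<le> p" for j
  proof -
    have "degree (coeff F j) \<le> n * Q + n"
      unfolding F_def W_def by (intro degree_coeff_mult_le degree_coeff_bipoly n)
    then show ?thesis by (simp add: p_def)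
  qed
  have F_mid: "coeff F j = 0" if "m \<le> j" "j < L" for j
  proof (rule poly_eqI)
    fix i
    show "coeff (coeff F j) i = coeff 0 i"
      using u(2)[of j i] that degx_F[of j]
      by (cases "i \<le> p") (simp_all add: F Z_def coeff_eq_0)
  qed
  have split: "F = T + monom 1 L * S"
    by (rule poly_eqI) (simp add: T_def S_def coeff_poly_cutoff coeff_poly_shift coeff_monom_mult)
  have deg_S: "degree S < m"
    using deg_F m(2) by (intro degree_lessI) (auto simp: S_def coeff_poly_shift coeff_eq_0)
  have deg_T: "degree T < m"
    using F_mid m(2) by (intro degree_lessI) (auto simp: T_def coeff_poly_cutoff)
  have W0: "W \<noteq> 0"
  proof
    assume "W = 0"
    from u(1) obtain z where z: "z \<in> X" "u z \<noteq> 0" by blast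
    then have "coeff (coeff W (snd z)) (fst z) = u z" by (auto simp: W_def X_def coeff_bipoly)
    with z(2) \<open>W = 0\<close> show False by simp
  qed
  have f0: "f \<noteq> 0" using m by auto
  show ?thesis
  proof (rule that[of S])
    show "S \<noteq> 0"
    proof
      \<comment> \<open>Then \<open>F = T\<close> would have degree below \<open>m\<close>, although
        it is a nonzero multiple of \<open>f\<close>.\<close>
      assume "S = 0"
      with split have "degree F < m" using deg_T by simp
      then show False using W0 f0 m(1) by (simp add: F_def degree_mult_eq)
    qed
    show "degree S < m" by (rule deg_S)
    show degx_S: "degree (coeff S j) \<le> n * (Q + 1)" for j
      using degx_F by (simp add: S_def coeff_poly_shift p_def)
    show S_le: "pole_le P (c * M P) (coeff (coeff S j) i)" for P i j
      using u(3) by (simp add: S_def coeff_poly_shift c F)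
    fix P a b assume "poly2 f a b = 0"
    then have "poly2 F a b = 0" by (simp add: F_def)
    then have eq: "b ^ L * poly2 S a b = - poly2 T a b"
      by (simp add: split poly_monom eq_neg_iff_add_eq_0 add.commute)
    have degx_T: "degree (coeff T j) \<le> p" for j
      using degx_F by (simp add: T_def coeff_poly_cutoff)
    have T_le: "pole_le P (c * M P) (coeff (coeff T j) i)" for i j
      using u(3) by (simp add: T_def coeff_poly_cutoff c F)
    have le: "degree S \<le> m - 1" "degree T \<le> m - 1" using deg_S deg_T by simp_all
    show "pole_le P (c * M P + int (n * (Q + 1)) * pole P a - int (m * Q) * pole P b) (poly2 S a b)"
    proof (cases "pole P b = 0")
      case True
      then show ?thesis using pole_le_poly2[OF le(1) degx_S S_le, of P a b] by simp
    next
      case False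
      then have b: "b \<noteq> 0" "pole P b = - place_ord P b"
        by (auto simp: pole_def max_def split: if_splits)
      \<comment> \<open>\<open>T\<close> costs only \<open>m - 1\<close> times the pole of
        \<open>b\<close>, while division by \<open>b ^ L\<close> gains \<open>L\<close> times
        it.\<close>
      have "pole_le P (c * M P + int p * pole P a + int (m - 1) * pole P b) (b ^ L * poly2 S a b)"
        unfolding eq using pole_le_poly2[OF le(2) degx_T T_le, of a b] by simp
      moreover have "place_ord P (b ^ L * poly2 S a b) =
          - (int (m * Q) + int (m - 1)) * pole P b + place_ord P (poly2 S a b)"
        if "poly2 S a b \<noteq> 0"
      proof -
        have "int L = int (m * Q) + int (m - 1)" using m(2) by (simp add: L_def q)
        with that b show ?thesis by (simp add: place_ord_mult place_ord_power algebra_simps)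
      qed
      ultimately show ?thesis using b(1)
        by (cases "poly2 S a b = 0") (simp_all add: pole_le_def p_def algebra_simps)
    qed
  qed
qed

text \<open>The product formula applies when \<open>S\<close> does not vanish at the point;
  otherwise \<open>S\<close> is passed on for elimination, and its small degree keeps
  \<open>f\<close> from dividing it.\<close>

lemma height_comparison:
  fixes f :: "'a::alg_closed_field diffpoly"
  assumes m: "degree f = m" "0 < m" and n: "\<And>j. degree (coeff f j) \<le> n" and Q: "0 < Q"
    and M: "\<And>P. 0 \<le> M P" "finite {P. M P \<noteq> 0}" "\<And>P i j. pole_le P (M P) (coeff (coeff f j) i)"
    and zero: "poly2 f a b = 0"
  defines "c \<equiv> 2 ^ ((m * Q - 1) * (n * (Q + 1) + 1)) :: int"
  obtains "int (m * Q) * height b \<le> int (n * (Q + 1)) * height a + c * Sum_any M"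
  | S where "\<not> f dvd S" "degree S < m" "\<And>j. degree (coeff S j) \<le> n * (Q + 1)"
    "\<And>P i j. pole_le P (c * M P) (coeff (coeff S j) i)" "poly2 S a b = 0"
proof -
  obtain S where S: "S \<noteq> 0" "degree S < m" "\<And>j. degree (coeff S j) \<le> n * (Q + 1)"
      "\<And>P i j. pole_le P (c * M P) (coeff (coeff S j) i)"
      "\<And>P a b. poly2 f a b = 0 \<Longrightarrow>
        pole_le P (c * M P + int (n * (Q + 1)) * pole P a - int (m * Q) * pole P b) (poly2 S a b)"
    by (rule exists_section[OF m n Q M(1,3), folded c_def]) (rule that)
  show ?thesis
  proof (cases "poly2 S a b = 0")
    case True
    have "\<not> f dvd S" using S(1,2) m(1) dvd_imp_degree_le[of f S] by auto
    with S(2-4) True show ?thesis using that(2) by blast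
  next
    case False
    define s where "s = poly2 S a b"
    \<comment> \<open>One finite set of places supports all functions involved, so their sums can be
      compared termwise.\<close>
    let ?U = "{P. M P \<noteq> 0} \<union> {P. pole P a \<noteq> 0} \<union> {P. pole P b \<noteq> 0} \<union> {P. place_ord P s \<noteq> 0}"
    have U: "finite ?U" by (auto intro: M(2) finite_pole finite_place_ord)
    have sup: "Sum_any g = sum g ?U" if "{P. g P \<noteq> 0} \<subseteq> ?U" for g :: "'a place \<Rightarrow> int"
      using U that by (rule Sum_any.expand_superset)
    have *: "(\<Sum>P\<in>?U. place_ord P s) = 0" "height a = (\<Sum>P\<in>?U. pole P a)"
      "height b = (\<Sum>P\<in>?U. pole P b)" "Sum_any M = sum M ?U"
      unfolding height_def by (subst sup[symmetric]; auto simp: product_formula)+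
    have "0 \<le> (\<Sum>P\<in>?U. place_ord P s + (c * M P + int (n * (Q + 1)) * pole P a - int (m * Q) * pole P b))"
    proof (rule sum_nonneg)
      fix P
      have "- place_ord P s \<le> c * M P + int (n * (Q + 1)) * pole P a - int (m * Q) * pole P b"
        using S(5)[OF zero, of P] False unfolding pole_le_def s_def by blast
      then show "0 \<le> place_ord P s +
          (c * M P + int (n * (Q + 1)) * pole P a - int (m * Q) * pole P b)" by linarith
    qed
    also have "\<dots> = (\<Sum>P\<in>?U. place_ord P s) + (c * sum M ?U +
        int (n * (Q + 1)) * (\<Sum>P\<in>?U. pole P a) - int (m * Q) * (\<Sum>P\<in>?U. pole P b))"
      by (simp only: sum.distrib sum_subtractf sum_distrib_left)
    finally have "0 \<le> c * Sum_any M + int (n * (Q + 1)) * height a - int (m * Q) * height b"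
      unfolding *(1) *(2-4)[symmetric] by simp
    then have "int (m * Q) * height b \<le> int (n * (Q + 1)) * height a + c * Sum_any M"
      by linarith
    then show ?thesis by (rule that(1))
  qed
qed

section \<open>Exchanging the two variables\<close>

text \<open>The successor compensates for the strict outer bound in \<open>bipoly\<close>.\<close>

definition swap :: "'a::field diffpoly \<Rightarrow> 'a diffpoly" where
  "swap f = bipoly (degree f) (Suc (deg_y f)) (\<lambda>(i, j). coeff (coeff f i) j)"

lemma degree_coeff_le_deg_y: "degree (coeff f j) \<le> deg_y f"
proof (cases "j \<le> degree f")
  case True
  then show ?thesis unfolding deg_y_def by (intro Max_ge) auto
qed (simp add: coeff_eq_0)

lemma coeff_swap [simp]: "coeff (coeff (swap f) j) i = coeff (coeff f i) j"
  using degree_coeff_le_deg_y[of f i] by (auto simp: swap_def coeff_bipoly coeff_eq_0)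

lemma poly2_eqI: "(\<And>i j. coeff (coeff F j) i = coeff (coeff G j) i) \<Longrightarrow> F = G"
  by (simp add: poly_eq_iff)

lemma swap_swap [simp]: "swap (swap f) = f"
  by (rule poly2_eqI) simp

lemma swap_mult: "swap (f * g) = swap f * swap g"
proof (rule poly2_eqI)
  fix i j
  show "coeff (coeff (swap (f * g)) j) i = coeff (coeff (swap f * swap g) j) i"
    by (simp add: coeff_mult coeff_sum) (rule sum.swap)
qed

lemma swap_dvd: "f dvd g \<Longrightarrow> swap f dvd swap g"
  by (metis dvd_def swap_mult)

lemma degree_coeff_swap_le: "degree (coeff (swap f) j) \<le> degree f"
  by (intro degree_le) (auto simp: coeff_eq_0)

lemma degree_swap_le:
  assumes "\<And>j. degree (coeff f j) \<le> d"
  shows "degree (swap f) \<le> d"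
proof (intro degree_le allI impI poly_eqI)
  fix j i assume "d < j"
  with assms[of i] show "coeff (coeff (swap f) j) i = coeff 0 i" by (simp add: coeff_eq_0)
qed

lemma degree_swap: "degree (swap f) = deg_y f"
proof (rule antisym)
  show "degree (swap f) \<le> deg_y f" by (intro degree_swap_le degree_coeff_le_deg_y)
  have "degree (coeff f j) \<le> degree (swap f)" for j
    using degree_coeff_swap_le[of "swap f" j] by simp
  then show "deg_y f \<le> degree (swap f)" unfolding deg_y_def by (intro Max.boundedI) auto
qed

lemma poly2_swap: "poly2 (swap f) b a = poly2 f a b"
  unfolding poly2_altdef[OF order_refl degree_coeff_le_deg_y, of f]
    poly2_altdef[OF eq_refl[OF degree_swap] degree_coeff_swap_le]
  by (subst sum.swap) (simp add: ac_simps)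

section \<open>Rational solutions\<close>

lemma diffpoly_eq_0_iff: "f = 0 \<longleftrightarrow> monomials f = {}"
  by (auto simp: monomials_def poly_eq_iff)

lemma monomials_le_tdeg: "(i, j) \<in> monomials f \<Longrightarrow> i + j \<le> tdeg f"
  unfolding tdeg_def by (rule Max_ge) (auto simp: finite_monomials image_iff intro!: bexI[of _ "(i, j)"])

lemma degree_coeff_add_le_tdeg:
  assumes "coeff f j \<noteq> 0"
  shows "degree (coeff f j) + j \<le> tdeg f"
  using assms by (intro monomials_le_tdeg) (simp add: monomials_def)

lemma degree_le_tdeg: "f \<noteq> 0 \<Longrightarrow> degree f \<le> tdeg f"
  using degree_coeff_add_le_tdeg[of f "degree f"] by simp

lemma deg_y_le_tdeg: "deg_y f \<le> tdeg f"
proof -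
  have "degree (coeff f j) \<le> tdeg f" for j
    using degree_coeff_add_le_tdeg[of f j] by (cases "coeff f j = 0") simp_all
  then show ?thesis unfolding deg_y_def by (intro Max.boundedI) auto
qed

text \<open>Division by a nonzero coefficient \<open>a\<close> makes one coefficient equal to
  \<open>1\<close>, so the local maxima \<open>M\<close> become nonnegative. By the product formula
  their sum is unchanged.\<close>

lemma normalized_coefficients:
  fixes f :: "'a::alg_closed_field diffpoly"
  assumes "f \<noteq> 0"
  obtains c M where "c \<noteq> 0" "\<And>P. 0 \<le> M P" "finite {P. M P \<noteq> 0}"
    "\<And>P i j. pole_le P (M P) (coeff (coeff (smult [:c:] f) j) i)"
    "Sum_any M = diffpoly_height f"
proof -
  obtain i0 j0 where ij: "(i0, j0) \<in> monomials f" using assms by (auto simp: diffpoly_eq_0_iff)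
  define a where "a = coeff (coeff f j0) i0"
  define A where "A = (\<lambda>(i, j). coeff (coeff f j) i) ` monomials f"
  define M where "M P = local_height A P + place_ord P a" for P
  have a: "a \<noteq> 0" "a \<in> A - {0}" using ij by (force simp: a_def A_def monomials_def)+
  have finA: "finite A" by (simp add: A_def finite_monomials)
  have A_le: "- place_ord P x \<le> local_height A P" if "x \<in> A - {0}" for P x
    unfolding local_height_def using finA that by (intro Max_ge) auto
  have finL: "finite {P. local_height A P \<noteq> 0}" using finA a(2) by (intro finite_local_height) auto
  have finM: "finite {P. M P \<noteq> 0}"
    by (rule finite_subset[OF _ finite_UnI[OF finL finite_place_ord[of a]]]) (auto simp: M_def)
  have inv: "place_ord P (inverse a) = - place_ord P a" for P
    using place_ord_mult[of a "inverse a" P] a(1) by simp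
  have "Sum_any M = Sum_any (local_height A) + Sum_any (\<lambda>P. place_ord P a)"
    unfolding M_def using finL finite_place_ord by (rule Sum_any.distrib)
  then have sum_M: "Sum_any M = proj_height A"
    by (simp add: product_formula proj_height_def Sum_any.expand_set)
  show ?thesis
  proof (rule that[of "inverse a" M])
    show "inverse a \<noteq> 0" using a(1) by simp
    show "0 \<le> M P" for P using A_le[OF a(2), of P] by (simp add: M_def)
    show "pole_le P (M P) (coeff (coeff (smult [:inverse a:] f) j) i)" for P i j
    proof (cases "coeff (coeff f j) i = 0")
      case False
      then have "coeff (coeff f j) i \<in> A - {0}" by (force simp: A_def monomials_def)
      with False a(1) A_le show ?thesis by (simp add: pole_le_def M_def inv place_ord_mult)
    qed simp
    show "Sum_any M = diffpoly_height f"
    proof (cases "card (monomials f) = 1")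
      case True
      \<comment> \<open>For a single term the normalized coefficient is \<open>1\<close> and
        \<open>M\<close> vanishes, in agreement with the convention for the height.\<close>
      then obtain z where "monomials f = {z}" by (rule card_1_singletonE)
      with ij have "monomials f = {(i0, j0)}" by auto
      then have "A = {a}" by (simp add: A_def a_def)
      then have "M = (\<lambda>_. 0)" using a(1) by (simp add: M_def local_height_def fun_eq_iff)
      with True show ?thesis by (simp add: diffpoly_height_def)
    qed (simp add: sum_M diffpoly_height_def A_def)
  qed (rule finM)
qed

lemma Sum_any_scaled_le:
  assumes "height a \<le> 2 ^ e * Sum_any (\<lambda>P. 2 ^ e' * M P)" "finite {P. M P \<noteq> 0}"
  shows "height a \<le> 2 ^ e * 2 ^ e' * Sum_any M"
  using assms by (simp add: Sum_any_right_distrib mult.assoc)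

text \<open>The comparison is applied to \<open>(r, r')\<close>. The choice of \<open>Q\<close>
  gives \<open>m * Q - n * (Q + 1) \<ge> (n + 1) ^ 2 - n * (n + 2) = 1\<close>; the additive term is
  \<open>m * Q\<close> times the loss of one in \<open>height_le_height_deriv\<close>.\<close>

lemma height_le_deg_y_less:
  fixes f :: "'a::{alg_closed_field, field_char_0} diffpoly"
  assumes f: "irreducible f" "degree f = m" "deg_y f = n" "n < m"
    and M: "\<And>P. 0 \<le> M P" "finite {P. M P \<noteq> 0}" "\<And>P i j. pole_le P (M P) (coeff (coeff f j) i)"
    and zero: "poly2 f r (ratfun_deriv r) = 0"
  defines "Q \<equiv> n + 1"
  defines "e1 \<equiv> (m * Q - 1) * (n * (Q + 1) + 1)"
    and "e2 \<equiv> (m + m - 1) * ((m + m) * (n * (Q + 1)) + 1)"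
  shows "height r \<le> 2 ^ e2 * 2 ^ e1 * Sum_any M + int (m * Q)"
proof -
  have m: "0 < m" and Q: "0 < Q" using f(4) by (simp_all add: Q_def)
  have n: "degree (coeff f j) \<le> n" for j using degree_coeff_le_deg_y[of f j] f(3) by simp
  have H: "0 \<le> Sum_any M" using Sum_any_mono[of "\<lambda>_. 0" M] M(1,2) by simp
  show ?thesis
  proof (cases rule: height_comparison[OF f(2) m n Q M zero, folded e1_def])
    case 1
    have "int m \<ge> int n + 1" using f(4) by simp
    then have "(int n + 1) * int Q \<le> int m * int Q" by (intro mult_right_mono) auto
    then have "1 \<le> int (m * Q) - int (n * (Q + 1))" by (simp add: Q_def algebra_simps)
    then have "1 * height r \<le> (int (m * Q) - int (n * (Q + 1))) * height r"
      by (intro mult_right_mono height_nonneg)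
    moreover have "int (m * Q) * height r \<le> int (m * Q) * (height (ratfun_deriv r) + 1)"
      by (intro mult_left_mono height_le_height_deriv) simp
    ultimately have "height r \<le> 2 ^ e1 * Sum_any M + int (m * Q)"
      using 1 by (simp only: left_diff_distrib distrib_left)
    \<comment> \<open>The factor \<open>2 ^ e2\<close> stems from elimination; inserting it here
      gives both alternatives the same bound.\<close>
    moreover have "1 * (2 ^ e1 * Sum_any M) \<le> 2 ^ e2 * (2 ^ e1 * Sum_any M)"
      using H by (intro mult_right_mono) auto
    ultimately show ?thesis unfolding mult.assoc mult_1 by linarith
  next
    case (2 S)
    have le: "M P \<le> 2 ^ e1 * M P" for P
      using mult_right_mono[of 1 "2 ^ e1" "M P"] M(1) by simp
    have "height r \<le> 2 ^ e2 * Sum_any (\<lambda>P. 2 ^ e1 * M P)"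
      unfolding e2_def
    proof (rule common_zero_height_le[OF f(1,2) m 2(1) _ _ 2(3)])
      show "degree (coeff f j) \<le> n * (Q + 1)" for j using n[of j] by (simp add: trans_le_add1)
      show "pole_le P (2 ^ e1 * M P) (coeff (coeff f j) i)" for P i j
        using M(3) le pole_le_mono by blast
    qed (use 2 M zero in auto)
    then have "height r \<le> 2 ^ e2 * 2 ^ e1 * Sum_any M" using M(2) by (rule Sum_any_scaled_le)
    then show ?thesis by (simp del: of_nat_mult)
  qed
qed

text \<open>The comparison is applied to \<open>swap f\<close> at \<open>(r', r)\<close>, with
  \<open>height r' \<le> 2 * height r\<close>. The choice of \<open>Q\<close> gives \<open>n * Q - 2
  * m * (Q + 1) \<ge> (2 * m + 1) ^ 2 - 2 * m * (2 * m + 2) = 1\<close>.\<close>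

lemma height_le_deg_y_greater:
  fixes f :: "'a::{alg_closed_field, field_char_0} diffpoly"
  assumes f: "irreducible f" "degree f = m" "0 < m" "deg_y f = n" "2 * m < n"
    and M: "\<And>P. 0 \<le> M P" "finite {P. M P \<noteq> 0}" "\<And>P i j. pole_le P (M P) (coeff (coeff f j) i)"
    and zero: "poly2 f r (ratfun_deriv r) = 0"
  defines "Q \<equiv> 2 * m + 1"
  defines "e1 \<equiv> (n * Q - 1) * (m * (Q + 1) + 1)"
    and "e2 \<equiv> (m + m * (Q + 1) - 1) * ((m + m * (Q + 1)) * n + 1)"
  shows "height r \<le> 2 ^ e2 * 2 ^ e1 * Sum_any M"
proof -
  have n: "0 < n" and Q: "0 < Q" using f(5) by (simp_all add: Q_def)
  have deg_n: "degree (swap f) = n" using f(4) by (simp add: degree_swap)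
  have deg_m: "degree (coeff (swap f) j) \<le> m" for j using degree_coeff_swap_le[of f j] f(2) by simp
  have M': "pole_le P (M P) (coeff (coeff (swap f) j) i)" for P i j using M(3) by simp
  have zero': "poly2 (swap f) (ratfun_deriv r) r = 0" using zero by (simp add: poly2_swap)
  have H: "0 \<le> Sum_any M" using Sum_any_mono[of "\<lambda>_. 0" M] M(1,2) by simp
  show ?thesis
  proof (cases rule: height_comparison[OF deg_n n deg_m Q M(1,2) M' zero', folded e1_def])
    case 1
    have "2 * int m + 1 \<le> int n" using f(5) by simp
    then have "(2 * int m + 1) * int Q \<le> int n * int Q" by (intro mult_right_mono) auto
    then have "1 \<le> int (n * Q) - 2 * int (m * (Q + 1))" by (simp add: Q_def algebra_simps)
    then have "1 * height r \<le> (int (n * Q) - 2 * int (m * (Q + 1))) * height r"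
      by (intro mult_right_mono height_nonneg)
    moreover have "height (ratfun_deriv r) \<le> 2 * height r"
      using ratfun_degree_deriv_le[of r] by (simp add: height_eq_degree)
    then have "int (m * (Q + 1)) * height (ratfun_deriv r) \<le> int (m * (Q + 1)) * (2 * height r)"
      by (intro mult_left_mono) simp_all
    ultimately have "height r \<le> 2 ^ e1 * Sum_any M"
      using 1 by (simp only: left_diff_distrib mult.left_commute[of _ 2] mult.assoc)
    moreover have "1 * (2 ^ e1 * Sum_any M) \<le> 2 ^ e2 * (2 ^ e1 * Sum_any M)"
      using H by (intro mult_right_mono) auto
    ultimately show ?thesis unfolding mult.assoc mult_1 by linarith
  next
    case (2 S)
    have le: "M P \<le> 2 ^ e1 * M P" for P
      using mult_right_mono[of 1 "2 ^ e1" "M P"] M(1) by simp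
    \<comment> \<open>The section is swapped back so that \<open>y'\<close> is eliminated, which
      bounds the height of \<open>r\<close> rather than that of \<open>r'\<close>.\<close>
    have "\<not> f dvd swap S" using 2(1) swap_dvd[of f "swap S"] by auto
    moreover have "degree (swap S) \<le> m * (Q + 1)" using 2(3) by (rule degree_swap_le)
    ultimately have "height r \<le> 2 ^ e2 * Sum_any (\<lambda>P. 2 ^ e1 * M P)"
      unfolding e2_def
    proof (rule common_zero_height_le[OF f(1-3)])
      show "degree (coeff f j) \<le> n" for j using degree_coeff_le_deg_y[of f j] f(4) by simp
      show "degree (coeff (swap S) j) \<le> n" for j
        using degree_coeff_swap_le[of S j] 2(2) by simp
      show "pole_le P (2 ^ e1 * M P) (coeff (coeff f j) i)" for P i j
        using M(3) le pole_le_mono by blast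
      show "poly2 (swap S) r (ratfun_deriv r) = 0" using 2(5) by (simp add: poly2_swap)
    qed (use 2 M zero in auto)
    then show ?thesis using M(2) by (rule Sum_any_scaled_le)
  qed
qed

section \<open>Estimates of the exponents in terms of the total degree\<close>

text \<open>The base \<open>2\<close> is at most \<open>R\<close>, and \<open>R ^ 8 + R ^ 4\<close>
  lies below the exponent on the right.\<close>

lemma two_powers_le:
  fixes R e1 e2 :: nat
  assumes "2 \<le> R" "e1 \<le> R ^ 4" "e2 \<le> R ^ 8"
  shows "(2::int) ^ e2 * 2 ^ e1 \<le> 75 * 2 ^ 13 * int R ^ (40 * R ^ 12 + 7)"
proof -
  have "R ^ 4 \<le> R ^ 12" "R ^ 8 \<le> R ^ 12" using assms(1) by (auto intro!: power_increasing)
  then have e: "e2 + e1 \<le> 40 * R ^ 12 + 7" using assms(2,3) by linarith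
  have "(2::int) ^ e2 * 2 ^ e1 = 2 ^ (e2 + e1)" by (simp add: power_add)
  also have "\<dots> \<le> int R ^ (e2 + e1)" using assms(1) by (intro power_mono) auto
  also have "\<dots> \<le> int R ^ (40 * R ^ 12 + 7)" using e assms(1) by (intro power_increasing) auto
  also have "\<dots> \<le> 75 * 2 ^ 13 * int R ^ (40 * R ^ 12 + 7)" by simp
  finally show ?thesis .
qed

lemma exponent_bounds_deg_y_less:
  fixes m n R :: nat
  assumes "m < R" "n < m"
  defines "Q \<equiv> n + 1"
  shows "(m * Q - 1) * (n * (Q + 1) + 1) \<le> R ^ 4"
    and "(m + m - 1) * ((m + m) * (n * (Q + 1)) + 1) \<le> R ^ 8"
    and "m * Q \<le> R ^ 2"
proof -
  obtain \<rho> where R: "R = Suc \<rho>" using assms(1) by (cases R) auto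
  have le: "m \<le> \<rho>" "n \<le> \<rho>" "Q \<le> R" "Q + 1 \<le> R + 1" and R2: "2 \<le> R"
    using assms R by (auto simp: Q_def)
  have "m * Q \<le> R * R" using assms(1) le by (intro mult_le_mono) auto
  then show mQ: "m * Q \<le> R ^ 2" by (simp add: power2_eq_square)
  \<comment> \<open>The bound is tight enough because
    \<open>\<rho> * (R + 1) + 1 = (R - 1) * (R + 1) + 1 = R ^ 2\<close>.\<close>
  have "n * (Q + 1) \<le> \<rho> * (R + 1)" using le by (intro mult_le_mono)
  then have nQ: "n * (Q + 1) + 1 \<le> R ^ 2" by (simp add: R power2_eq_square)
  have "(m * Q - 1) * (n * (Q + 1) + 1) \<le> R ^ 2 * R ^ 2" using mQ nQ by (intro mult_le_mono) auto
  then show "(m * Q - 1) * (n * (Q + 1) + 1) \<le> R ^ 4" by (simp flip: power_add)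
  have "m + m \<le> R * R" using mult_le_mono[OF R2, of m R] assms(1) by simp
  then have mm: "m + m \<le> R ^ 2" by (simp add: power2_eq_square)
  have "(m + m) * (n * (Q + 1)) \<le> R ^ 2 * R ^ 2" using mm nQ by (intro mult_le_mono) auto
  then have 1: "(m + m) * (n * (Q + 1)) + 1 \<le> R ^ 4 + 1" by (simp flip: power_add)
  have "R ^ 4 + 1 \<le> R ^ 4 * 2" using R2 by simp
  also have "\<dots> \<le> R ^ 4 * R ^ 2" using R2 by (intro mult_le_mono) (auto simp: power2_eq_square intro: order_trans[OF _ le_square])
  finally have "(m + m) * (n * (Q + 1)) + 1 \<le> R ^ 6" using 1 by (simp flip: power_add)
  then have "(m + m - 1) * ((m + m) * (n * (Q + 1)) + 1) \<le> R ^ 2 * R ^ 6"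
    using mm by (intro mult_le_mono) auto
  then show "(m + m - 1) * ((m + m) * (n * (Q + 1)) + 1) \<le> R ^ 8" by (simp flip: power_add)
qed

lemma exponent_bounds_deg_y_greater:
  fixes m n R :: nat
  assumes "n < R" "0 < m" "2 * m < n"
  defines "Q \<equiv> 2 * m + 1"
  shows "(n * Q - 1) * (m * (Q + 1) + 1) \<le> R ^ 4"
    and "(m + m * (Q + 1) - 1) * ((m + m * (Q + 1)) * n + 1) \<le> R ^ 8"
proof -
  have le: "m + 1 \<le> R" "Q + 1 \<le> R" "n \<le> R" "3 \<le> R" using assms by (auto simp: Q_def)
  have "n * Q \<le> R * R" using le by (intro mult_le_mono) auto
  then have nQ: "n * Q \<le> R ^ 2" by (simp add: power2_eq_square)
  \<comment> \<open>The extra summand \<open>Q + 1 = 2 * m + 2\<close> in the expansion absorbs both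
    the \<open>1\<close> and the \<open>m\<close> of the two brackets.\<close>
  have "(m + 1) * (Q + 1) \<le> R * R" using le by (intro mult_le_mono) auto
  then have mQ: "m * (Q + 1) + (Q + 1) \<le> R ^ 2" by (simp add: power2_eq_square)
  then have mQ': "m * (Q + 1) + 1 \<le> R ^ 2" "m + m * (Q + 1) \<le> R ^ 2" by (auto simp: Q_def)
  have "(n * Q - 1) * (m * (Q + 1) + 1) \<le> R ^ 2 * R ^ 2"
    using nQ mQ' by (intro mult_le_mono) auto
  then show "(n * Q - 1) * (m * (Q + 1) + 1) \<le> R ^ 4" by (simp flip: power_add)
  have "(m + m * (Q + 1)) * n \<le> R ^ 2 * R" using mQ' le by (intro mult_le_mono) auto
  then have 1: "(m + m * (Q + 1)) * n + 1 \<le> R ^ 3 + 1"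
    by (simp add: power2_eq_square power3_eq_cube)
  have "R ^ 3 + 1 \<le> R ^ 3 * R ^ 3" using le(4) one_le_power[of R 3] mult_le_mono[of 2 "R ^ 3" "R ^ 3" "R ^ 3"]
      self_le_power[of R 3] by simp
  then have "(m + m * (Q + 1)) * n + 1 \<le> R ^ 6" using 1 by (simp flip: power_add)
  then have "(m + m * (Q + 1) - 1) * ((m + m * (Q + 1)) * n + 1) \<le> R ^ 2 * R ^ 6"
    using mQ' by (intro mult_le_mono) auto
  then show "(m + m * (Q + 1) - 1) * ((m + m * (Q + 1)) * n + 1) \<le> R ^ 8" by (simp flip: power_add)
qed

section \<open>The degree bound for rational solutions\<close>

theorem theorem3p2:
  fixes f :: "'k::{alg_closed_field, field_char_0} diffpoly"
    and r :: "'k ratfun"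
    and \<rho> :: nat
  assumes "irreducible f"
    and "deg_y' f \<ge> 1"
    and "deg_y f > 2 * deg_y' f \<or> deg_y f < deg_y' f"
    and "\<rho> = tdeg f"
    and "rational_solution f r"
    and "ratfun_degree r \<ge> 1"
  shows "int (ratfun_degree r) \<le>
    (if deg_y f > 2 * deg_y' f
     then 75 * 2 ^ 13 * (int \<rho> + 1) ^ (40 * (\<rho> + 1) ^ 12 + 7) * diffpoly_height f
     else 75 * 2 ^ 13 * (int \<rho> + 1) ^ (40 * (\<rho> + 1) ^ 12 + 7) * diffpoly_height f
          + (int \<rho> + 1) ^ 2)"
proof -
  define m n R where "m = deg_y' f" and "n = deg_y f" and "R = \<rho> + 1"
  have f0: "f \<noteq> 0" using assms(1) by auto
  obtain c M where c: "c \<noteq> 0" and M: "\<And>P. 0 \<le> M P" "finite {P. M P \<noteq> 0}"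
      "\<And>P i j. pole_le P (M P) (coeff (coeff (smult [:c:] f) j) i)"
      and H: "Sum_any M = diffpoly_height f"
    using normalized_coefficients[OF f0] by metis
  let ?F = "smult [:c:] f"
  \<comment> \<open>Scaling by a nonzero constant of \<open>k(t)\<close> preserves irreducibility,
    both partial degrees and the solutions.\<close>
  have "[:[:c:]:] * f = ?F" by simp
  moreover have "is_unit [:[:c:]:]" using c by (simp add: is_unit_const_poly_iff is_unit_pCons_iff)
  ultimately have irr: "irreducible ?F" using assms(1) irreducible_mult_unit_left by metis
  have deg: "degree ?F = m" "deg_y ?F = n" using c by (simp_all add: m_def n_def deg_y_def)
  have zero: "poly2 ?F r (ratfun_deriv r) = 0"
    using assms(5) by (simp add: rational_solution_def)
  have mn: "m < R" "n < R"
    using degree_le_tdeg[OF f0] deg_y_le_tdeg[of f] assms(4) by (simp_all add: m_def n_def R_def)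
  have m: "0 < m" using assms(2) by (simp add: m_def)
  have H0: "0 \<le> diffpoly_height f"
    unfolding H[symmetric] using Sum_any_mono[of "\<lambda>_. 0" M] M(1,2) by simp
  have R: "int \<rho> + 1 = int R" "\<rho> + 1 = R" "2 \<le> R" using mn m by (simp_all add: R_def)
  show ?thesis
  proof (cases "deg_y f > 2 * deg_y' f")
    case True
    then have nm: "2 * m < n" by (simp add: m_def n_def)
    note e = exponent_bounds_deg_y_greater[OF mn(2) m nm]
    have "height r \<le> 75 * 2 ^ 13 * int R ^ (40 * R ^ 12 + 7) * diffpoly_height f"
      using height_le_deg_y_greater[OF irr deg(1) m deg(2) nm M zero, unfolded H]
        mult_right_mono[OF two_powers_le[OF R(3) e] H0]
      by (rule order_trans)
    then show ?thesis unfolding if_P[OF True] R(1,2) height_eq_degree .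
  next
    case False
    with assms(3) have nm: "n < m" by (simp add: m_def n_def)
    note e = exponent_bounds_deg_y_less[OF mn(1) nm]
    \<comment> \<open>Here \<open>n + 1\<close> is the parameter \<open>Q\<close>; this product is
      the additive term in the second case.\<close>
    have "int (m * (n + 1)) \<le> int R ^ 2"
      using e(3) by (simp only: of_nat_power[symmetric] of_nat_le_iff)
    with mult_right_mono[OF two_powers_le[OF R(3) e(1,2)] H0]
    have "2 ^ ((m + m - 1) * ((m + m) * (n * (n + 1 + 1)) + 1)) *
          2 ^ ((m * (n + 1) - 1) * (n * (n + 1 + 1) + 1)) * diffpoly_height f + int (m * (n + 1))
        \<le> 75 * 2 ^ 13 * int R ^ (40 * R ^ 12 + 7) * diffpoly_height f + int R ^ 2"
      by (rule add_mono)
    with height_le_deg_y_less[OF irr deg nm M zero, unfolded H]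
    have "height r \<le> 75 * 2 ^ 13 * int R ^ (40 * R ^ 12 + 7) * diffpoly_height f + int R ^ 2"
      by (rule order_trans)
    then show ?thesis unfolding if_not_P[OF False] R(1,2) height_eq_degree .
  qed
qed

end
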